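(* Fix constants $p>0$, $\nu>0$, $\tau>0$, $C_1>0$ and $C_2\ge 0$ with $p\nu>2$. Let $M$ be a complete Riemannian manifold that admits a positive harmonic function $h$, defined outside a compact set, such that the function $\rho=h^{-1/\nu}$ is proper and satisfies $|\nabla\rho|\ge c_0>0$ for some constant $c_0$. Then there are constants $R_0>0$, $\epsilon_0>0$ and $C>0$ such that the following holds. For each $R>R_0$ and $0<\epsilon<\epsilon_0$, if a nonnegative function $u$ on $M$ satisfies $$\Delta u\ge -C_1u^{p+1}-C_2\rho^{-2-\tau}u\quad\text{and}\quad u\le \epsilon\rho^{-\frac2p}\quad\text{in }\{\rho\ge R\},$$ then $$u\le C\epsilon R^{\nu-\frac2p}\rho^{-\nu}\quad\text{in }\{\rho\ge R\}.$$
   Context: $\Delta$ is the Laplace-Beltrami operator with the sign convention $\Delta=\operatorname{div}\nabla$ (so $\Delta=\sum_i\partial_i^2$ on Euclidean space). The constants $R_0,\epsilon_0,C$ do not depend on $u$, $R$ or $\epsilon$. The function $h$ is defined on the complement of a compact set of $M$. "$\rho$ is proper" means that $\rho\to\infty$ at infinity in $M$; after enlarging the compact set, $\rho$ is taken to be bounded near it, so that for $R$ large $\{\rho\ge R\}$ is a closed subset of $M$ contained in the domain of $h$, and $\{R\le\rho\le S\}$ is compact for all $S>R$. *)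

theory Defs
  imports "HOL-Analysis.Analysis"
begin

section \<open>Functions of class \<open>C\<^sup>k\<close> on open subsets of Euclidean space\<close>

definition partial :: "'n::finite \<Rightarrow> (real^'n \<Rightarrow> real) \<Rightarrow> real^'n \<Rightarrow> real" where
  "partial i f y = frechet_derivative f (at y) (axis i 1)"

primrec Ck_on :: "nat \<Rightarrow> (real^'n::finite) set \<Rightarrow> (real^'n \<Rightarrow> real) \<Rightarrow> bool" where
  "Ck_on 0 S f \<longleftrightarrow> continuous_on S f"
| "Ck_on (Suc k) S f \<longleftrightarrow>
     (\<forall>y\<in>S. f differentiable (at y)) \<and> (\<forall>i. Ck_on k S (partial i f))"

definition smooth_on :: "(real^'n::finite) set \<Rightarrow> (real^'n \<Rightarrow> real) \<Rightarrow> bool" where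
  "smooth_on S f \<longleftrightarrow> (\<forall>k. Ck_on k S f)"


section \<open>Riemannian manifolds\<close>

text \<open>A chart is a pair \<open>(U, \<phi>)\<close>. The manifold described by an atlas is the union of the
  chart domains, an open subset of a Hausdorff second countable space. A metric assigns to each
  chart its Gram matrix \<open>(g\<^sub>i\<^sub>j)\<close>, as a function of the coordinates.\<close>

type_synonym ('a, 'n) chart = "'a set \<times> ('a \<Rightarrow> real^'n)"

type_synonym ('a, 'n) metric_tensor = "('a, 'n) chart \<Rightarrow> real^'n \<Rightarrow> real^'n^'n"

abbreviation chart_dom :: "('a, 'n::finite) chart \<Rightarrow> 'a set" where
  "chart_dom c \<equiv> fst c"

abbreviation coord :: "('a, 'n::finite) chart \<Rightarrow> 'a \<Rightarrow> real^'n" where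
  "coord c \<equiv> snd c"

definition param :: "('a, 'n::finite) chart \<Rightarrow> real^'n \<Rightarrow> 'a" where
  "param c = inv_into (chart_dom c) (coord c)"

definition carrier_of :: "('a, 'n::finite) chart set \<Rightarrow> 'a set" where
  "carrier_of A = (\<Union>c\<in>A. chart_dom c)"

definition transition :: "('a, 'n::finite) chart \<Rightarrow> ('a, 'n) chart \<Rightarrow> real^'n \<Rightarrow> real^'n" where
  "transition c d = coord d \<circ> param c"

locale riemannian_manifold =
  fixes A :: "('a::{t2_space, second_countable_topology}, 'n::finite) chart set"
    and g :: "('a, 'n) metric_tensor"
  assumes open_chart_dom: "c \<in> A \<Longrightarrow> open (chart_dom c)"
    and open_chart_image: "c \<in> A \<Longrightarrow> open (coord c ` chart_dom c)"
    and homeomorphism_chart: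
      "c \<in> A \<Longrightarrow> homeomorphism (chart_dom c) (coord c ` chart_dom c) (coord c) (param c)"
    and smooth_transition:
      "c \<in> A \<Longrightarrow> d \<in> A \<Longrightarrow>
        smooth_on (coord c ` (chart_dom c \<inter> chart_dom d)) (\<lambda>y. transition c d y $ i)"
    and smooth_metric:
      "c \<in> A \<Longrightarrow> smooth_on (coord c ` chart_dom c) (\<lambda>y. g c y $ i $ j)"
    and symmetric_metric:
      "c \<in> A \<Longrightarrow> y \<in> coord c ` chart_dom c \<Longrightarrow> transpose (g c y) = g c y"
    and positive_definite_metric:
      "c \<in> A \<Longrightarrow> y \<in> coord c ` chart_dom c \<Longrightarrow> v \<noteq> 0 \<Longrightarrow> v \<bullet> (g c y *v v) > 0"
    and metric_transformation:
      "c \<in> A \<Longrightarrow> d \<in> A \<Longrightarrow> y \<in> coord c ` (chart_dom c \<inter> chart_dom d) \<Longrightarrow>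
        g c y =
          transpose (jacobian (transition c d) (at y))
          ** g d (transition c d y)
          ** jacobian (transition c d) (at y)"

text \<open>Coordinate expressions below are evaluated in an arbitrarily chosen chart around the
  point; by the transformation law they do not depend on this choice.\<close>

definition chart_at :: "('a, 'n::finite) chart set \<Rightarrow> 'a \<Rightarrow> ('a, 'n) chart" where
  "chart_at A x = (SOME c. c \<in> A \<and> x \<in> chart_dom c)"


section \<open>Gradient and Laplace-Beltrami operator\<close>

definition C2_on :: "('a, 'n::finite) chart set \<Rightarrow> 'a set \<Rightarrow> ('a \<Rightarrow> real) \<Rightarrow> bool" where
  "C2_on A U f \<longleftrightarrow> (\<forall>c\<in>A. Ck_on 2 (coord c ` (U \<inter> chart_dom c)) (f \<circ> param c))"

text \<open>\<open>(\<nabla>f)\<^sup>i = g\<^sup>i\<^sup>j \<partial>\<^sub>j f\<close>\<close>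

definition local_grad ::
  "('a, 'n::finite) metric_tensor \<Rightarrow> ('a, 'n) chart \<Rightarrow> ('a \<Rightarrow> real) \<Rightarrow> real^'n \<Rightarrow> real^'n" where
  "local_grad g c f y = matrix_inv (g c y) *v (\<chi> j. partial j (f \<circ> param c) y)"

definition norm_grad ::
  "('a, 'n::finite) chart set \<Rightarrow> ('a, 'n) metric_tensor \<Rightarrow> ('a \<Rightarrow> real) \<Rightarrow> 'a \<Rightarrow> real" where
  "norm_grad A g f x =
    (let c = chart_at A x; y = coord c x
     in sqrt (local_grad g c f y \<bullet> (g c y *v local_grad g c f y)))"

text \<open>\<open>div X = (det g)\<^sup>-\<^sup>1\<^sup>/\<^sup>2 \<partial>\<^sub>i ((det g)\<^sup>1\<^sup>/\<^sup>2 X\<^sup>i)\<close>\<close>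

definition local_div ::
  "('a, 'n::finite) metric_tensor \<Rightarrow> ('a, 'n) chart \<Rightarrow> (real^'n \<Rightarrow> real^'n) \<Rightarrow> real^'n \<Rightarrow> real" where
  "local_div g c X y =
    (\<Sum>i\<in>UNIV. partial i (\<lambda>z. sqrt (det (g c z)) * X z $ i) y) / sqrt (det (g c y))"

definition laplacian ::
  "('a, 'n::finite) chart set \<Rightarrow> ('a, 'n) metric_tensor \<Rightarrow> ('a \<Rightarrow> real) \<Rightarrow> 'a \<Rightarrow> real" where
  "laplacian A g f x =
    (let c = chart_at A x in local_div g c (local_grad g c f) (coord c x))"

definition harmonic_on ::
  "('a, 'n::finite) chart set \<Rightarrow> ('a, 'n) metric_tensor \<Rightarrow> 'a set \<Rightarrow> ('a \<Rightarrow> real) \<Rightarrow> bool" where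
  "harmonic_on A g U f \<longleftrightarrow> C2_on A U f \<and> (\<forall>x\<in>U. laplacian A g f x = 0)"


section \<open>Completeness\<close>

definition piecewise_C1_curve ::
  "('a::topological_space, 'n::finite) chart set \<Rightarrow> (real \<Rightarrow> 'a) \<Rightarrow> bool" where
  "piecewise_C1_curve A \<gamma> \<longleftrightarrow>
    path \<gamma> \<and> path_image \<gamma> \<subseteq> carrier_of A \<and>
    (\<forall>c\<in>A. \<forall>a b. 0 \<le> a \<and> b \<le> 1 \<and> \<gamma> ` {a..b} \<subseteq> chart_dom c \<longrightarrow>
       (coord c \<circ> \<gamma>) piecewise_C1_differentiable_on {a..b})"

definition speed ::
  "('a, 'n::finite) chart set \<Rightarrow> ('a, 'n) metric_tensor \<Rightarrow> (real \<Rightarrow> 'a) \<Rightarrow> real \<Rightarrow> real" where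
  "speed A g \<gamma> t =
    (let c = chart_at A (\<gamma> t); v = vector_derivative (coord c \<circ> \<gamma>) (at t)
     in sqrt (v \<bullet> (g c (coord c (\<gamma> t)) *v v)))"

text \<open>The library's piecewise \<open>C\<^sup>1\<close> functions may have unbounded derivative near the exceptional
  points, so lengths take values in \<open>[0, \<infinity>]\<close>. The distance of points in different components
  is \<open>\<infinity>\<close>.\<close>

definition curve_length ::
  "('a, 'n::finite) chart set \<Rightarrow> ('a, 'n) metric_tensor \<Rightarrow> (real \<Rightarrow> 'a) \<Rightarrow> ennreal" where
  "curve_length A g \<gamma> = (\<integral>\<^sup>+t\<in>{0..1}. ennreal (speed A g \<gamma> t) \<partial>lborel)"

definition riemannian_dist ::
  "('a::topological_space, 'n::finite) chart set \<Rightarrow> ('a, 'n) metric_tensor \<Rightarrow> 'a \<Rightarrow> 'a \<Rightarrow> ennreal"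
where
  "riemannian_dist A g x y =
    (INF \<gamma>\<in>{\<gamma>. piecewise_C1_curve A \<gamma> \<and> pathstart \<gamma> = x \<and> pathfinish \<gamma> = y}.
      curve_length A g \<gamma>)"

definition metrically_complete ::
  "('a::topological_space, 'n::finite) chart set \<Rightarrow> ('a, 'n) metric_tensor \<Rightarrow> bool" where
  "metrically_complete A g \<longleftrightarrow>
    (\<forall>s :: nat \<Rightarrow> 'a. range s \<subseteq> carrier_of A \<and>
       (\<forall>e>0. \<exists>N. \<forall>m\<ge>N. \<forall>n\<ge>N. riemannian_dist A g (s m) (s n) < ennreal e) \<longrightarrow>
       (\<exists>l\<in>carrier_of A. (\<lambda>n. riemannian_dist A g (s n) l) \<longlonglongrightarrow> 0))"

locale complete_riemannian_manifold = riemannian_manifold A g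
  for A :: "('a::{t2_space, second_countable_topology}, 'n::finite) chart set"
    and g :: "('a, 'n) metric_tensor" +
  assumes complete: "metrically_complete A g"


section \<open>Functions defined outside a compact set\<close>

text \<open>For a function \<open>f\<close> defined on \<open>M - K\<close>: it tends to infinity at infinity in \<open>M\<close>, and it is
  bounded above near \<open>K\<close>. The second condition can always be achieved for continuous \<open>f\<close> by
  enlarging \<open>K\<close>; it makes \<open>{x \<in> M - K. R \<le> f x}\<close> closed in \<open>M\<close> for large \<open>R\<close>.\<close>

definition proper_outside :: "'a::topological_space set \<Rightarrow> 'a set \<Rightarrow> ('a \<Rightarrow> real) \<Rightarrow> bool" where
  "proper_outside M K f \<longleftrightarrow>
    (\<forall>B. \<exists>L. compact L \<and> L \<subseteq> M \<and> (\<forall>x \<in> M - (K \<union> L). f x > B)) \<and>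
    (\<exists>V. open V \<and> K \<subseteq> V \<and> bdd_above (f ` ((M \<inter> V) - K)))"

end

theory Submission
  imports Defs
begin

text \<open>Since \<open>h\<close> is harmonic, \<open>\<Delta>(F \<circ> h) = F''(h) |\<nabla>h|\<^sup>2\<close>, and \<open>|\<nabla>\<rho>| \<ge> c\<^sub>0\<close> means
  \<open>|\<nabla>h|\<^sup>2 \<ge> \<nu>\<^sup>2 c\<^sub>0\<^sup>2 \<rho>\<^sup>-\<^sup>2 h\<^sup>2\<close>. Write the inequality as \<open>\<Delta>u \<ge> - V u\<close> with
  \<open>V = C\<^sub>1 u\<^sup>p + C\<^sub>2 \<rho>\<^sup>-\<^sup>2\<^sup>-\<^sup>\<tau>\<close>. The a priori bound makes \<open>V\<close> a small multiple of \<open>\<rho>\<^sup>-\<^sup>2\<close>, so that for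
  \<open>0 < s < 1\<close> the power \<open>h\<^sup>s\<close> is a supersolution of \<open>\<Delta> + V\<close>. With \<open>\<nu>s > 2/p\<close>, comparison improves the
  bound on \<open>u\<close> to decay of order \<open>\<rho>\<^sup>-\<^sup>\<nu>\<^sup>s\<close>. Then \<open>V\<close> decays faster than \<open>\<rho>\<^sup>-\<^sup>2\<close> by a factor
  \<open>(R/\<rho>)\<^sup>\<nu>\<^sup>t\<close>, so that \<open>h - R\<^sup>\<nu>\<^sup>t h\<^sup>1\<^sup>+\<^sup>t / 2\<close>, which lies between \<open>h / 2\<close> and \<open>h\<close>, is a supersolution,
  and a second comparison gives the full rate. Comparison is the maximum principle for the quotient
  of \<open>u\<close> and a strict supersolution.\<close>

section \<open>Partial derivatives\<close>

lemma sum_axis_mult: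
  fixes c :: "'n::finite \<Rightarrow> real"
  shows "(\<Sum>i\<in>UNIV. axis k 1 $ i * c i) = c k"
  by (simp add: axis_def if_distrib if_distribR cong: if_cong)

lemma partial_has_derivative:
  assumes "(f has_derivative D) (at y)"
  shows "partial i f y = D (axis i 1)"
  using frechet_derivative_at[OF assms] by (simp add: partial_def)

lemma has_derivative_partial:
  assumes "f differentiable (at y)"
  shows "(f has_derivative (\<lambda>v. \<Sum>i\<in>UNIV. v $ i * partial i f y)) (at y)"
proof -
  let ?D = "frechet_derivative f (at y)"
  have D: "(f has_derivative ?D) (at y)"
    using assms frechet_derivative_works by blast
  interpret linear ?D using D by (rule has_derivative_linear)
  have "?D v = (\<Sum>i\<in>UNIV. v $ i * partial i f y)" for v
  proof -
    have "?D v = ?D (\<Sum>i\<in>UNIV. (v $ i) *\<^sub>R axis i 1)"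
      using basis_expansion[of v] by (simp add: scalar_mult_eq_scaleR)
    also have "\<dots> = (\<Sum>i\<in>UNIV. v $ i * partial i f y)"
      by (simp add: sum scaleR partial_def)
    finally show ?thesis .
  qed
  then have "?D = (\<lambda>v. \<Sum>i\<in>UNIV. v $ i * partial i f y)" by (rule ext)
  with D show ?thesis by (simp only:)
qed

lemma has_derivative_transform_eventually_nhds:
  assumes "(f has_derivative D) (at y)" "\<forall>\<^sub>F z in nhds y. f z = g z"
  shows "(g has_derivative D) (at y)"
proof -
  obtain N where "open N" "y \<in> N" "\<And>z. z \<in> N \<Longrightarrow> f z = g z"
    using assms(2) unfolding eventually_nhds by blast
  then show ?thesis
    using has_derivative_transform_within_open[OF assms(1)] by blast
qed

text \<open>Functions with the same germ at \<open>y\<close> have the same derivatives there, so the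
  choice operator inside \<open>frechet_derivative\<close> returns the same map for both, even at
  points where no derivative exists.\<close>

lemma partial_cong:
  assumes "\<forall>\<^sub>F z in nhds y. f z = g z"
  shows "partial i f y = partial i g y"
proof -
  have "\<forall>\<^sub>F z in nhds y. g z = f z" using assms by (simp add: eq_commute)
  then have "(f has_derivative D) (at y) \<longleftrightarrow> (g has_derivative D) (at y)" for D
    using assms has_derivative_transform_eventually_nhds by blast
  then show ?thesis by (simp add: partial_def frechet_derivative_def)
qed

lemma differentiable_cong_nhds:
  assumes "\<forall>\<^sub>F z in nhds y. f z = g z"
  shows "f differentiable (at y) \<longleftrightarrow> g differentiable (at y)"
proof -
  have "\<forall>\<^sub>F z in nhds y. g z = f z" using assms by (simp add: eq_commute)
  then show ?thesis
    using assms has_derivative_transform_eventually_nhds unfolding differentiable_def by blast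
qed

lemma partial_diff_scale:
  assumes "f differentiable (at y)" "h differentiable (at y)"
  shows "partial i (\<lambda>z. f z - m * h z) y = partial i f y - m * partial i h y"
  by (subst partial_has_derivative[OF has_derivative_diff[OF _ has_derivative_mult_right]],
      (rule has_derivative_partial assms)+)
    (simp add: sum_axis_mult)

lemma partial_mult:
  assumes "f differentiable (at y)" "h differentiable (at y)"
  shows "partial i (\<lambda>z. f z * h z) y = f y * partial i h y + partial i f y * h y"
  by (subst partial_has_derivative[OF has_derivative_mult],
      (rule has_derivative_partial assms)+)
    (simp add: sum_axis_mult)

lemma partial_sum:
  assumes "\<And>k. k \<in> I \<Longrightarrow> f k differentiable (at y)"
  shows "partial i (\<lambda>z. \<Sum>k\<in>I. f k z) y = (\<Sum>k\<in>I. partial i (f k) y)"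
  by (subst partial_has_derivative[OF has_derivative_sum],
      (rule has_derivative_partial assms | assumption)+)
    (simp add: sum_axis_mult)

lemma has_derivative_compose_real:
  fixes f :: "real^'n \<Rightarrow> real"
  assumes "f differentiable (at y)" "(F has_real_derivative F') (at (f y))"
  shows "((\<lambda>z. F (f z)) has_derivative
           (\<lambda>v. F' * (\<Sum>i\<in>UNIV. v $ i * partial i f y))) (at y)"
  using has_derivative_compose[OF has_derivative_partial[OF assms(1)], of F "(*) F'"] assms(2)
  by (simp add: has_field_derivative_def)

lemma partial_compose_real:
  assumes "f differentiable (at y)" "(F has_real_derivative F') (at (f y))"
  shows "partial i (\<lambda>z. F (f z)) y = F' * partial i f y"
  by (subst partial_has_derivative[OF has_derivative_compose_real[OF assms]])
    (simp add: sum_axis_mult)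

lemma differentiable_compose_real:
  fixes f :: "real^'n \<Rightarrow> real"
  assumes "f differentiable (at y)" "(F has_real_derivative F') (at (f y))"
  shows "(\<lambda>z. F (f z)) differentiable (at y)"
  using has_derivative_compose_real[OF assms] differentiable_def by blast

text \<open>A pointwise form of C^2: the function is differentiable near \<open>y\<close>, so that
  its partials are meaningful nearby, and these can be differentiated once more at \<open>y\<close>.
  This is what the second derivative test along lines and the second order chain rule
  consume.\<close>

definition twice_differentiable :: "(real^'n::finite \<Rightarrow> real) \<Rightarrow> real^'n \<Rightarrow> bool" where
  "twice_differentiable f y \<longleftrightarrow>
     (\<forall>\<^sub>F z in nhds y. f differentiable (at z)) \<and> (\<forall>i. partial i f differentiable (at y))"

lemma twice_differentiable_imp_differentiable:
  "twice_differentiable f y \<Longrightarrow> f differentiable (at y)"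
  by (auto simp: twice_differentiable_def dest: eventually_nhds_x_imp_x)

lemma Ck_on_2_imp_twice_differentiable:
  assumes "open S" "y \<in> S" "Ck_on 2 S f"
  shows "twice_differentiable f y"
  using assms eventually_nhds_in_open[OF assms(1,2)]
  by (auto simp: twice_differentiable_def numeral_2_eq_2 elim!: eventually_mono)

lemma second_partial_diff_scale:
  assumes f: "twice_differentiable f y" and h: "twice_differentiable h y"
  shows twice_differentiable_diff_scale: "twice_differentiable (\<lambda>z. f z - m * h z) y"
    and "partial i (partial j (\<lambda>z. f z - m * h z)) y =
      partial i (partial j f) y - m * partial i (partial j h) y"
proof -
  have ev: "\<forall>\<^sub>F z in nhds y. f differentiable (at z) \<and> h differentiable (at z)"
    using f h by (simp add: twice_differentiable_def eventually_conj)
  have eq: "\<forall>\<^sub>F z in nhds y.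
      partial j f z - m * partial j h z = partial j (\<lambda>z. f z - m * h z) z" for j
    using ev by (rule eventually_mono) (simp add: partial_diff_scale)
  have d: "partial j f differentiable (at y)" "partial j h differentiable (at y)" for j
    using f h by (auto simp: twice_differentiable_def)
  have "(\<lambda>z. partial j f z - m * partial j h z) differentiable (at y)" for j
    using d by (intro differentiable_diff differentiable_mult) auto
  moreover have "\<forall>\<^sub>F z in nhds y. (\<lambda>z. f z - m * h z) differentiable (at z)"
    using ev by (rule eventually_mono) (auto intro!: differentiable_diff differentiable_mult)
  ultimately show "twice_differentiable (\<lambda>z. f z - m * h z) y"
    unfolding twice_differentiable_def using differentiable_cong_nhds[OF eq] by blast
  show "partial i (partial j (\<lambda>z. f z - m * h z)) y =
      partial i (partial j f) y - m * partial i (partial j h) y"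
    using partial_cong[OF eq, of i] partial_diff_scale[OF d] by simp
qed

text \<open>The first order chain rule holds on a neighbourhood, so its right-hand side may replace
  the partial of the composite before the product rule is applied. \<open>F'\<close> is a derivative
  only near the value of \<open>f\<close> because the outer functions will be powers, smooth on the
  positive reals only.\<close>

lemma second_partial_compose_real:
  assumes f: "twice_differentiable f y"
    and F': "\<forall>\<^sub>F z in nhds y. (F has_real_derivative F' (f z)) (at (f z))"
    and F'': "(F' has_real_derivative F'') (at (f y))"
  shows twice_differentiable_compose_real: "twice_differentiable (\<lambda>z. F (f z)) y"
    and "partial i (partial j (\<lambda>z. F (f z))) y =
      F'' * (partial i f y * partial j f y) + F' (f y) * partial i (partial j f) y"
proof -
  have ev: "\<forall>\<^sub>F z in nhds y. f differentiable (at z) \<and> (F has_real_derivative F' (f z)) (at (f z))"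
    using f F' by (simp add: twice_differentiable_def eventually_conj)
  have eq: "\<forall>\<^sub>F z in nhds y. F' (f z) * partial j f z = partial j (\<lambda>z. F (f z)) z" for j
    using ev by (rule eventually_mono) (rule partial_compose_real[symmetric], auto)
  have d1: "f differentiable (at y)"
    using f by (rule twice_differentiable_imp_differentiable)
  have d: "(\<lambda>z. F' (f z)) differentiable (at y)" "partial j f differentiable (at y)" for j
    using f differentiable_compose_real[OF d1 F''] by (auto simp: twice_differentiable_def)
  have "(\<lambda>z. F' (f z) * partial j f z) differentiable (at y)" for j
    using d by (rule differentiable_mult)
  moreover have "\<forall>\<^sub>F z in nhds y. (\<lambda>z. F (f z)) differentiable (at z)"
    using ev by (rule eventually_mono) (blast intro: differentiable_compose_real)
  ultimately show "twice_differentiable (\<lambda>z. F (f z)) y"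
    unfolding twice_differentiable_def using differentiable_cong_nhds[OF eq] by blast
  show "partial i (partial j (\<lambda>z. F (f z))) y =
      F'' * (partial i f y * partial j f y) + F' (f y) * partial i (partial j f) y"
    using partial_cong[OF eq, of i] partial_mult[OF d] partial_compose_real[OF d1 F'']
    by (simp add: add.commute mult.assoc)
qed

section \<open>Local maxima in Euclidean space\<close>

text \<open>If \<open>l\<close> were positive while \<open>\<phi>' 0 = 0\<close>, then
  \<open>\<phi>'\<close> would be positive just to the right of 0, and by the mean value theorem
  \<open>\<phi>\<close> would exceed \<open>\<phi> 0\<close> there.\<close>

lemma second_derivative_nonpos_at_local_max:
  fixes \<phi> :: "real \<Rightarrow> real"
  assumes "d > 0" and \<phi>': "\<And>t. \<bar>t\<bar> < d \<Longrightarrow> (\<phi> has_real_derivative \<phi>' t) (at t)"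
    and \<phi>'': "(\<phi>' has_real_derivative l) (at 0)"
    and max: "\<And>t. \<bar>t\<bar> < d \<Longrightarrow> \<phi> t \<le> \<phi> 0"
  shows "\<phi>' 0 = 0" and "l \<le> 0"
proof -
  show z: "\<phi>' 0 = 0"
    using DERIV_local_max[OF \<phi>'[of 0] \<open>d > 0\<close>] \<open>d > 0\<close> max by simp
  show "l \<le> 0"
  proof (rule ccontr)
    assume "\<not> l \<le> 0"
    then obtain e where e: "e > 0" "\<And>h. 0 < h \<Longrightarrow> h < e \<Longrightarrow> 0 < \<phi>' h"
      using DERIV_pos_inc_right[OF \<phi>''] z by auto
    define t where "t = min d e / 2"
    have t: "0 < t" "t < d" "t < e" using \<open>d > 0\<close> e(1) by (auto simp: t_def)
    have "\<exists>z>0. z < t \<and> \<phi> t - \<phi> 0 = (t - 0) * \<phi>' z"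
      using t by (intro MVT2) (auto intro!: \<phi>')
    then obtain z where "0 < z" "z < t" "\<phi> t - \<phi> 0 = t * \<phi>' z" by auto
    moreover from this have "\<phi>' z > 0" using e(2) t by simp
    ultimately have "\<phi> t > \<phi> 0" using t by (metis diff_gt_0_iff_gt mult_pos_pos)
    with max[of t] t show False by simp
  qed
qed

text \<open>Restriction to the lines through \<open>y\<close> reduces both claims to one
  variable.\<close>

lemma partials_at_local_max:
  fixes f :: "real^'n::finite \<Rightarrow> real"
  assumes f: "twice_differentiable f y" and max: "\<forall>\<^sub>F z in nhds y. f z \<le> f y"
  shows "partial j f y = 0"
    and "(\<Sum>i\<in>UNIV. \<Sum>j\<in>UNIV. partial i (partial j f) y * v i * v j) \<le> 0"
proof -
  have "\<forall>\<^sub>F z in nhds y. f differentiable (at z) \<and> f z \<le> f y"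
    using f max by (simp add: twice_differentiable_def eventually_conj)
  then obtain e where e: "e > 0"
    "\<And>z. dist z y < e \<Longrightarrow> f differentiable (at z) \<and> f z \<le> f y"
    unfolding eventually_nhds_metric by blast
  have dir: "(\<Sum>i\<in>UNIV. w $ i * partial i f y) = 0 \<and>
      (\<Sum>i\<in>UNIV. w $ i * (\<Sum>j\<in>UNIV. w $ j * partial j (partial i f) y)) \<le> 0" for w :: "real^'n"
  proof -
    \<comment> \<open>Adding 1 to the norm covers the direction \<open>w = 0\<close> as
      well.\<close>
    define d where "d = e / (norm w + 1)"
    have d: "d > 0" using e by (simp add: d_def add_nonneg_pos)
    have near: "dist (y + t *\<^sub>R w) y < e" if "\<bar>t\<bar> < d" for t
    proof -
      have "\<bar>t\<bar> * norm w \<le> \<bar>t\<bar> * (norm w + 1)" by (simp add: mult_left_mono)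
      also have "\<dots> < e"
        using that by (simp add: d_def pos_less_divide_eq add_nonneg_pos)
      finally show ?thesis by (simp add: dist_norm)
    qed
    have line: "((\<lambda>t. y + t *\<^sub>R w) has_derivative (\<lambda>t. t *\<^sub>R w)) (at t)" for t
      by (auto intro!: derivative_eq_intros)
    have along: "((\<lambda>t. k (y + t *\<^sub>R w)) has_real_derivative
        (\<Sum>i\<in>UNIV. w $ i * partial i k (y + t *\<^sub>R w))) (at t)"
      if "k differentiable (at (y + t *\<^sub>R w))" for k t
      using has_derivative_compose[OF line has_derivative_partial[OF that]]
      by (simp add: has_field_derivative_def mult.assoc mult_commute_abs flip: sum_distrib_left)
    have d1: "((\<lambda>t. f (y + t *\<^sub>R w)) has_real_derivative
        (\<Sum>i\<in>UNIV. w $ i * partial i f (y + t *\<^sub>R w))) (at t)" if "\<bar>t\<bar> < d" for t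
      using along e(2) near[OF that] by blast
    have d2: "((\<lambda>t. \<Sum>i\<in>UNIV. w $ i * partial i f (y + t *\<^sub>R w)) has_real_derivative
        (\<Sum>i\<in>UNIV. w $ i * (\<Sum>j\<in>UNIV. w $ j * partial j (partial i f) y))) (at 0)"
      using f along[of _ 0] by (intro DERIV_sum DERIV_cmult) (auto simp: twice_differentiable_def)
    show ?thesis
      using second_derivative_nonpos_at_local_max[OF d d1 d2] e(2) near by simp
  qed
  show "partial j f y = 0"
    using dir[of "axis j 1"] by (simp add: sum_axis_mult)
  \<comment> \<open>The second derivative along a line carries the two indices in the opposite
    order; exchanging the sums renames them.\<close>
  have "(\<Sum>i\<in>UNIV. \<Sum>j\<in>UNIV. partial i (partial j f) y * v i * v j) =
      (\<Sum>j\<in>UNIV. \<Sum>i\<in>UNIV. partial i (partial j f) y * v i * v j)"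
    by (rule sum.swap)
  also have "\<dots> \<le> 0"
    using dir[of "\<chi> i. v i"] by (simp add: sum_distrib_left mult_ac)
  finally show "(\<Sum>i\<in>UNIV. \<Sum>j\<in>UNIV. partial i (partial j f) y * v i * v j) \<le> 0" .
qed

section \<open>Positive semidefinite matrices\<close>

text \<open>Removing one row and column at a time by a Schur complement writes \<open>P\<close> as a sum of squares.
  If the pivot \<open>P k k\<close> vanishes, so does its row, and division by \<open>0\<close> makes the correction vanish.\<close>

lemma psd_contraction_nonpos:
  fixes P H :: "'n::finite \<Rightarrow> 'n \<Rightarrow> real"
  assumes "finite S" and "\<And>i j. P i j = P j i" and "\<And>i j. i \<notin> S \<Longrightarrow> P i j = 0"
    and "\<And>v. (\<Sum>i\<in>UNIV. \<Sum>j\<in>UNIV. P i j * v i * v j) \<ge> 0"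
    and H: "\<And>v. (\<Sum>i\<in>UNIV. \<Sum>j\<in>UNIV. H i j * v i * v j) \<le> 0"
  shows "(\<Sum>i\<in>UNIV. \<Sum>j\<in>UNIV. P i j * H i j) \<le> 0"
  using assms(1-4)
proof (induction S arbitrary: P rule: finite_induct)
  case empty
  then show ?case by simp
next
  case (insert k S)
  note sym = insert.prems(1) and supp = insert.prems(2) and psd = insert.prems(3)
  define d where "d = P k k"
  define c where "c v = (\<Sum>i\<in>UNIV. P i k * v i)" for v
  define P' where "P' i j = P i j - P i k * P j k / d" for i j
  \<comment> \<open>The form evaluated at \<open>v\<close> plus \<open>t\<close> times the
    \<open>k\<close>-th basis vector, as a quadratic polynomial in \<open>t\<close>.\<close>
  have shift: "0 \<le> (\<Sum>i\<in>UNIV. \<Sum>j\<in>UNIV. P i j * v i * v j) + 2 * t * c v + t\<^sup>2 * d" for v t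
  proof -
    define e where "e i = (if i = k then 1 else 0 :: real)" for i
    have e: "(\<Sum>i\<in>UNIV. a i * e i) = a k" "(\<Sum>i\<in>UNIV. a i * e i * b i) = a k * b k" for a b
      by (simp_all add: e_def if_distrib if_distribR cong: if_cong)
    have "(\<Sum>i\<in>UNIV. \<Sum>j\<in>UNIV. P i j * (v i + t * e i) * (v j + t * e j)) =
      (\<Sum>i\<in>UNIV. \<Sum>j\<in>UNIV. P i j * v i * v j) +
      t * (\<Sum>i\<in>UNIV. \<Sum>j\<in>UNIV. P i j * v i * e j) +
      t * (\<Sum>i\<in>UNIV. \<Sum>j\<in>UNIV. P i j * e i * v j) +
      t\<^sup>2 * (\<Sum>i\<in>UNIV. \<Sum>j\<in>UNIV. P i j * e i * e j)"
      by (simp only: sum_distrib_left sum.distrib[symmetric])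
        (auto intro!: sum.cong simp: algebra_simps power2_eq_square)
    also have "(\<Sum>i\<in>UNIV. \<Sum>j\<in>UNIV. P i j * v i * e j) = c v"
      by (simp add: c_def e)
    also have "(\<Sum>i\<in>UNIV. \<Sum>j\<in>UNIV. P i j * e i * v j) = c v"
      by (subst sum.swap) (simp add: c_def e sym[of k])
    also have "(\<Sum>i\<in>UNIV. \<Sum>j\<in>UNIV. P i j * e i * e j) = d"
      by (simp add: d_def e)
    finally show ?thesis using psd[of "\<lambda>i. v i + t * e i"] by (simp add: algebra_simps)
  qed
  have d: "d \<ge> 0" using shift[of "\<lambda>i. 0" 1] by (simp add: c_def)
  \<comment> \<open>For \<open>d = 0\<close> the polynomial in \<open>shift\<close> is affine in
    \<open>t\<close> and bounded below, so its slope vanishes. The \<open>t\<close> chosen below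
    would give it the value -1.\<close>
  have c0: "c v = 0" if "d = 0" for v
  proof (rule ccontr)
    let ?Q = "\<Sum>i\<in>UNIV. \<Sum>j\<in>UNIV. P i j * v i * v j"
    assume "c v \<noteq> 0"
    then show False using shift[of v "- (?Q + 1) / (2 * c v)"] that by (simp add: field_simps)
  qed
  have row0: "P i k = 0" if "d = 0" for i
    using c0[OF that, of "\<lambda>j. if j = i then 1 else 0"] by (simp add: c_def if_distrib cong: if_cong)
  have split: "(\<Sum>i\<in>UNIV. \<Sum>j\<in>UNIV. P i j * G i j) = (\<Sum>i\<in>UNIV. \<Sum>j\<in>UNIV. P' i j * G i j) +
      (\<Sum>i\<in>UNIV. \<Sum>j\<in>UNIV. G i j * P i k * P j k) / d" for G
    by (simp only: sum_divide_distrib sum.distrib[symmetric] P'_def)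
      (auto intro!: sum.cong simp: algebra_simps)
  have "(\<Sum>i\<in>UNIV. \<Sum>j\<in>UNIV. P' i j * H i j) \<le> 0"
  proof (rule insert.IH)
    show "P' i j = P' j i" for i j by (simp add: P'_def sym[of i j] mult_ac)
    show "P' i j = 0" if "i \<notin> S" for i j
      using that supp[of i] row0 sym[of k j] by (cases "i = k") (auto simp: P'_def d_def)
    show "(\<Sum>i\<in>UNIV. \<Sum>j\<in>UNIV. P' i j * v i * v j) \<ge> 0" for v
    proof -
      have "(\<Sum>i\<in>UNIV. \<Sum>j\<in>UNIV. v i * v j * P i k * P j k) = (c v)\<^sup>2"
        by (simp add: c_def power2_eq_square sum_product mult_ac)
      then have "(\<Sum>i\<in>UNIV. \<Sum>j\<in>UNIV. P' i j * v i * v j) =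
          (\<Sum>i\<in>UNIV. \<Sum>j\<in>UNIV. P i j * v i * v j) - (c v)\<^sup>2 / d"
        using split[of "\<lambda>i j. v i * v j"] by (simp add: mult.assoc)
      \<comment> \<open>Completing the square: \<open>t = - c v / d\<close> minimises the polynomial
        in \<open>shift\<close>. For \<open>d = 0\<close> this quotient is 0 by convention and
        \<open>c v = 0\<close>, so the identity persists.\<close>
      moreover have "\<dots> = (\<Sum>i\<in>UNIV. \<Sum>j\<in>UNIV. P i j * v i * v j) + 2 * (- c v / d) * c v + (- c v / d)\<^sup>2 * d"
        using c0 by (cases "d = 0") (simp_all add: power2_eq_square field_simps)
      ultimately show ?thesis using shift[of v "- c v / d"] by simp
    qed
  qed
  \<comment> \<open>The rank one part split off from \<open>P\<close> contracts with
    \<open>H\<close> to the form of \<open>H\<close> at the \<open>k\<close>-th column of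
    \<open>P\<close>.\<close>
  moreover have "(\<Sum>i\<in>UNIV. \<Sum>j\<in>UNIV. H i j * P i k * P j k) / d \<le> 0"
    using H[of "\<lambda>i. P i k"] d by (rule divide_nonpos_nonneg)
  ultimately show ?case using split[of H] by simp
qed

section \<open>Determinants and inverses of differentiable matrix functions\<close>

lemma differentiable_det:
  fixes B :: "real^'n::finite \<Rightarrow> real^'m::finite^'m"
  assumes "\<And>i j. (\<lambda>z. B z $ i $ j) differentiable (at y)"
  shows "(\<lambda>z. det (B z)) differentiable (at y)"
proof -
  have prod: "(\<lambda>z. \<Prod>i\<in>I. B z $ i $ q i) differentiable (at y)" if "finite I" for q and I :: "'m set"
    using that by induction (auto intro!: differentiable_mult assms)
  show ?thesis unfolding det_def
    by (intro differentiable_sum differentiable_mult) (auto intro: prod finite_permutations)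
qed

lemma matrix_inv_eqs:
  fixes B :: "real^'n::finite^'n"
  assumes "det B \<noteq> 0"
  shows "B ** matrix_inv B = mat 1" "matrix_inv B ** B = mat 1"
proof -
  obtain C where "B ** C = mat 1 \<and> C ** B = mat 1"
    using assms unfolding invertible_det_nz[symmetric] invertible_def by blast
  then have "B ** matrix_inv B = mat 1 \<and> matrix_inv B ** B = mat 1"
    unfolding matrix_inv_def by (rule someI)
  then show "B ** matrix_inv B = mat 1" "matrix_inv B ** B = mat 1" by auto
qed

text \<open>Cramer's rule for the \<open>l\<close>-th column of the inverse. It makes the entries
  rational functions of the entries of \<open>B\<close>, and their differentiability is read off
  from that.\<close>

lemma matrix_inv_entry:
  fixes B :: "real^'n::finite^'n"
  assumes "det B \<noteq> 0"
  shows "matrix_inv B $ k $ l =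
    det (\<chi> i j. if j = k then axis l 1 $ i else B $ i $ j) / det B"
proof -
  have "B *v (matrix_inv B *v axis l 1) = axis l 1"
    by (simp add: matrix_vector_mul_assoc matrix_inv_eqs[OF assms])
  then have "matrix_inv B *v axis l 1 =
      (\<chi> k. det (\<chi> i j. if j = k then axis l 1 $ i else B $ i $ j) / det B)"
    by (simp add: cramer[OF assms])
  then have "(matrix_inv B *v axis l 1) $ k =
      det (\<chi> i j. if j = k then axis l 1 $ i else B $ i $ j) / det B"
    by (simp only: vec_lambda_beta)
  moreover have "(matrix_inv B *v axis l 1) $ k = matrix_inv B $ k $ l"
    by (simp add: matrix_vector_mult_def axis_def if_distrib cong: if_cong)
  ultimately show ?thesis by (simp only:)
qed

lemma differentiable_matrix_inv:
  fixes B :: "real^'n::finite \<Rightarrow> real^'m::finite^'m"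
  assumes B: "\<And>i j. (\<lambda>z. B z $ i $ j) differentiable (at y)"
    and nz: "\<forall>\<^sub>F z in nhds y. det (B z) \<noteq> 0"
  shows "(\<lambda>z. matrix_inv (B z) $ k $ l) differentiable (at y)"
proof -
  let ?C = "\<lambda>z. \<chi> i j. if j = k then axis l 1 $ i else B z $ i $ j"
  have "(\<lambda>z. ?C z $ i $ j) differentiable (at y)" for i j
    using B by (cases "j = k") auto
  then have "(\<lambda>z. det (?C z) / det (B z)) differentiable (at y)"
    using nz by (intro differentiable_divide differentiable_det B)
      (auto dest: eventually_nhds_x_imp_x)
  moreover have "\<forall>\<^sub>F z in nhds y. det (?C z) / det (B z) = matrix_inv (B z) $ k $ l"
    using nz by (rule eventually_mono) (simp add: matrix_inv_entry)
  ultimately show ?thesis by (simp add: differentiable_cong_nhds)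
qed

lemma pos_def_imp_det_nonzero:
  fixes B :: "real^'n::finite^'n"
  assumes "\<And>v. v \<noteq> 0 \<Longrightarrow> v \<bullet> (B *v v) > 0"
  shows "det B \<noteq> 0"
proof -
  have "\<forall>v. B *v v = 0 \<longrightarrow> v = 0" using assms by force
  then have "invertible B"
    using matrix_left_invertible_ker invertible_left_inverse by blast
  then show ?thesis by (simp add: invertible_det_nz)
qed

lemma matrix_inv_symmetric:
  fixes B :: "real^'n::finite^'n"
  assumes "det B \<noteq> 0" "transpose B = B"
  shows "transpose (matrix_inv B) = matrix_inv B"
proof -
  have "transpose (matrix_inv B) ** B = mat 1"
    using matrix_transpose_mul[of B "matrix_inv B"] matrix_inv_eqs[OF assms(1)] assms(2)
    by (simp add: transpose_mat)
  then have "transpose (matrix_inv B) ** (B ** matrix_inv B) = matrix_inv B"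
    by (simp add: matrix_mul_assoc)
  then show ?thesis by (simp add: matrix_inv_eqs[OF assms(1)])
qed

section \<open>The Laplacian in a chart\<close>

text \<open>Stated in the chart that \<open>laplacian\<close> and \<open>norm_grad\<close> select at
  \<open>x\<close>, so that Euclidean calculus applies to exactly the coordinate expressions
  occurring there.\<close>

definition twice_differentiable_at ::
  "('a, 'n::finite) chart set \<Rightarrow> ('a \<Rightarrow> real) \<Rightarrow> 'a \<Rightarrow> bool" where
  "twice_differentiable_at A f x \<longleftrightarrow>
     twice_differentiable (f \<circ> param (chart_at A x)) (coord (chart_at A x) x)"

lemma smooth_on_imp_differentiable:
  "smooth_on S f \<Longrightarrow> y \<in> S \<Longrightarrow> f differentiable (at y)"
  unfolding smooth_on_def by (metis Ck_on.simps(2))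

lemma inner_matrix_vector_mult:
  fixes B :: "real^'n::finite^'n"
  shows "v \<bullet> (B *v w) = (\<Sum>i\<in>UNIV. \<Sum>j\<in>UNIV. B $ i $ j * v $ i * w $ j)"
  by (simp add: inner_vec_def matrix_vector_mult_def sum_distrib_left mult_ac)

context riemannian_manifold
begin

lemma
  assumes "x \<in> carrier_of A"
  shows chart_at_in_atlas: "chart_at A x \<in> A"
    and in_chart_at_dom: "x \<in> chart_dom (chart_at A x)"
proof -
  have "\<exists>c. c \<in> A \<and> x \<in> chart_dom c" using assms by (auto simp: carrier_of_def)
  then have "chart_at A x \<in> A \<and> x \<in> chart_dom (chart_at A x)"
    unfolding chart_at_def by (rule someI_ex)
  then show "chart_at A x \<in> A" "x \<in> chart_dom (chart_at A x)" by auto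
qed

lemma param_coord: "c \<in> A \<Longrightarrow> x \<in> chart_dom c \<Longrightarrow> param c (coord c x) = x"
  using homeomorphism_chart homeomorphism_apply1 by blast

lemma open_carrier: "open (carrier_of A)"
  unfolding carrier_of_def using open_chart_dom by blast

lemma open_coord_image:
  assumes "c \<in> A" "open U"
  shows "open (coord c ` (U \<inter> chart_dom c))"
proof -
  have "openin (top_of_set (chart_dom c)) (U \<inter> chart_dom c)"
    using assms(2) by (metis inf_commute openin_open_Int)
  then have "openin (top_of_set (coord c ` chart_dom c)) (coord c ` (U \<inter> chart_dom c))"
    using homeomorphism_imp_open_map homeomorphism_chart[OF assms(1)] by blast
  then show ?thesis using open_chart_image[OF assms(1)] openin_open_trans by blast
qed

lemma eventually_nhds_coord:
  assumes "c \<in> A" "x \<in> chart_dom c" "\<forall>\<^sub>F x' in nhds x. Q x'"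
  shows "\<forall>\<^sub>F z in nhds (coord c x). Q (param c z)"
proof -
  obtain U where U: "open U" "x \<in> U" "\<And>x'. x' \<in> U \<Longrightarrow> Q x'"
    using assms(3) unfolding eventually_nhds by blast
  have "coord c x \<in> coord c ` (U \<inter> chart_dom c)" using U assms by blast
  moreover have "Q (param c z)" if "z \<in> coord c ` (U \<inter> chart_dom c)" for z
    using that U(3) param_coord[OF assms(1)] by auto
  ultimately show ?thesis
    using open_coord_image[OF assms(1) U(1)] unfolding eventually_nhds by blast
qed

lemma C2_on_imp_twice_differentiable_at:
  assumes "C2_on A U f" "open U" "x \<in> U" "x \<in> carrier_of A"
  shows "twice_differentiable_at A f x"
  unfolding twice_differentiable_at_def
proof (rule Ck_on_2_imp_twice_differentiable)
  let ?c = "chart_at A x"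
  have c: "?c \<in> A" "x \<in> chart_dom ?c"
    using chart_at_in_atlas[OF assms(4)] in_chart_at_dom[OF assms(4)] by auto
  show "open (coord ?c ` (U \<inter> chart_dom ?c))" using c assms open_coord_image by blast
  show "coord ?c x \<in> coord ?c ` (U \<inter> chart_dom ?c)" using c assms by blast
  show "Ck_on 2 (coord ?c ` (U \<inter> chart_dom ?c)) (f \<circ> param ?c)"
    using c assms by (simp add: C2_on_def)
qed

lemma twice_differentiable_at_imp_isCont:
  assumes "twice_differentiable_at A f x" "x \<in> carrier_of A"
  shows "isCont f x"
proof -
  let ?c = "chart_at A x"
  have c: "?c \<in> A" "x \<in> chart_dom ?c"
    using chart_at_in_atlas[OF assms(2)] in_chart_at_dom[OF assms(2)] by auto
  have "isCont (f \<circ> param ?c) (coord ?c x)"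
    using assms(1) twice_differentiable_imp_differentiable differentiable_imp_continuous_within
    unfolding twice_differentiable_at_def by blast
  moreover have "continuous_on (chart_dom ?c) (coord ?c)"
    using homeomorphism_chart[OF c(1)] homeomorphism_def by blast
  then have "isCont (coord ?c) x"
    using open_chart_dom[OF c(1)] c(2) continuous_on_eq_continuous_at by blast
  ultimately have "isCont (\<lambda>x'. (f \<circ> param ?c) (coord ?c x')) x"
    using isCont_o2 by blast
  moreover have "\<forall>\<^sub>F x' in nhds x. (f \<circ> param ?c) (coord ?c x') = f x'"
    using eventually_nhds_in_open[OF open_chart_dom[OF c(1)] c(2)]
    by (rule eventually_mono) (simp add: param_coord[OF c(1)])
  ultimately show ?thesis by (simp only: isCont_cong[symmetric])
qed

section \<open>The Laplacian in nondivergence form\<close>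

definition inv_metric :: "'a \<Rightarrow> 'n \<Rightarrow> 'n \<Rightarrow> real" where
  "inv_metric x i j =
    matrix_inv (g (chart_at A x) (coord (chart_at A x) x)) $ i $ j"

text \<open>In terms of Christoffel symbols this is the contraction - g^{ik} Gamma^j_{ik}, the
  coefficient of the first order part of the Laplacian.\<close>

definition lap_drift :: "'a \<Rightarrow> 'n \<Rightarrow> real" where
  "lap_drift x j =
    (let c = chart_at A x; y = coord c x in
      \<Sum>i\<in>UNIV. partial i (\<lambda>z. sqrt (det (g c z)) * matrix_inv (g c z) $ i $ j) y
        / sqrt (det (g c y)))"

lemma det_metric_nonzero:
  "c \<in> A \<Longrightarrow> y \<in> coord c ` chart_dom c \<Longrightarrow> det (g c y) \<noteq> 0"
  using positive_definite_metric pos_def_imp_det_nonzero by blast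

lemma metric_inner_nonneg:
  "c \<in> A \<Longrightarrow> y \<in> coord c ` chart_dom c \<Longrightarrow> v \<bullet> (g c y *v v) \<ge> 0"
  using positive_definite_metric[of c y v] by (cases "v = 0") auto

lemma metric_mult_inv:
  "c \<in> A \<Longrightarrow> y \<in> coord c ` chart_dom c \<Longrightarrow> g c y *v (matrix_inv (g c y) *v v) = v"
  by (simp add: matrix_vector_mul_assoc matrix_inv_eqs det_metric_nonzero)

lemma inv_metric_sym:
  assumes "x \<in> carrier_of A"
  shows "inv_metric x i j = inv_metric x j i"
proof -
  have c: "chart_at A x \<in> A" "coord (chart_at A x) x \<in> coord (chart_at A x) ` chart_dom (chart_at A x)"
    using chart_at_in_atlas[OF assms] in_chart_at_dom[OF assms] by auto
  show ?thesis
    unfolding inv_metric_def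
    by (subst matrix_inv_symmetric[OF det_metric_nonzero[OF c] symmetric_metric[OF c], symmetric])
      (simp add: transpose_def)
qed

text \<open>With \<open>w = G *v v\<close> for the inverse matrix \<open>G\<close>, the form of
  \<open>G\<close> at \<open>v\<close> equals the form of the metric at \<open>w\<close>.\<close>

lemma inv_metric_psd:
  assumes "x \<in> carrier_of A"
  shows "(\<Sum>i\<in>UNIV. \<Sum>j\<in>UNIV. inv_metric x i j * v i * v j) \<ge> 0"
proof -
  define G where "G = matrix_inv (g (chart_at A x) (coord (chart_at A x) x))"
  have c: "chart_at A x \<in> A" "coord (chart_at A x) x \<in> coord (chart_at A x) ` chart_dom (chart_at A x)"
    using chart_at_in_atlas[OF assms] in_chart_at_dom[OF assms] by auto
  have "0 \<le> (\<chi> i. v i) \<bullet> (G *v (\<chi> i. v i))"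
    using metric_inner_nonneg[OF c, of "G *v (\<chi> i. v i)"]
    by (simp add: G_def metric_mult_inv[OF c] inner_commute)
  then show ?thesis by (simp add: inner_matrix_vector_mult inv_metric_def G_def)
qed

lemma norm_grad_square_eq:
  assumes "x \<in> carrier_of A"
  shows "(norm_grad A g f x)\<^sup>2 = (\<Sum>i\<in>UNIV. \<Sum>j\<in>UNIV. inv_metric x i j *
    (partial i (f \<circ> param (chart_at A x)) (coord (chart_at A x) x) *
     partial j (f \<circ> param (chart_at A x)) (coord (chart_at A x) x)))"
proof -
  define c where "c = chart_at A x"
  define y where "y = coord c x"
  define G where "G = matrix_inv (g c y)"
  define p where "p = (\<chi> j. partial j (f \<circ> param c) y)"
  have c: "c \<in> A" "y \<in> coord c ` chart_dom c"
    using chart_at_in_atlas[OF assms] in_chart_at_dom[OF assms] by (auto simp: c_def y_def)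
  have "(norm_grad A g f x)\<^sup>2 = (G *v p) \<bullet> (g c y *v (G *v p))"
    using metric_inner_nonneg[OF c, of "G *v p"]
    by (simp add: norm_grad_def Let_def local_grad_def c_def y_def G_def p_def)
  also have "\<dots> = p \<bullet> (G *v p)"
    unfolding G_def by (simp only: metric_mult_inv[OF c] inner_commute)
  also have "\<dots> = (\<Sum>i\<in>UNIV. \<Sum>j\<in>UNIV. G $ i $ j * (p $ i * p $ j))"
    by (simp add: inner_matrix_vector_mult mult.assoc)
  finally show ?thesis by (simp add: p_def c_def y_def G_def inv_metric_def)
qed

text \<open>The product rule applied to the divergence separates a second order part, with positive
  semidefinite coefficients, from a first order part, which vanishes at critical points.\<close>

lemma laplacian_eq:
  assumes x: "x \<in> carrier_of A" and f: "twice_differentiable_at A f x"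
  shows "laplacian A g f x =
    (\<Sum>i\<in>UNIV. \<Sum>j\<in>UNIV. inv_metric x i j *
      partial i (partial j (f \<circ> param (chart_at A x))) (coord (chart_at A x) x)) +
    (\<Sum>j\<in>UNIV. lap_drift x j * partial j (f \<circ> param (chart_at A x)) (coord (chart_at A x) x))"
proof -
  define c where "c = chart_at A x"
  define y where "y = coord c x"
  have c: "c \<in> A" "y \<in> coord c ` chart_dom c"
    using chart_at_in_atlas[OF x] in_chart_at_dom[OF x] by (auto simp: c_def y_def)
  define r where "r z = sqrt (det (g c z))" for z
  define a where "a i j z = r z * matrix_inv (g c z) $ i $ j" for i j z
  define \<phi> where "\<phi> = f \<circ> param c"
  have ev_det: "\<forall>\<^sub>F z in nhds y. det (g c z) \<noteq> 0"
    using eventually_nhds_in_open[OF open_chart_image[OF c(1)] c(2)]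
    by (rule eventually_mono) (rule det_metric_nonzero[OF c(1)])
  have r: "r y \<noteq> 0" using det_metric_nonzero[OF c] by (simp add: r_def)
  have dg: "(\<lambda>z. g c z $ i $ j) differentiable (at y)" for i j
    using smooth_metric[OF c(1)] c(2) by (rule smooth_on_imp_differentiable)
  have "r differentiable (at y)"
  proof -
    \<comment> \<open>What is known about the determinant here is that it is nonzero. The real
      square root is extended as an odd function, so it is differentiable at negative arguments too,
      which accounts for the second branch.\<close>
    have "(sqrt has_real_derivative
        (if det (g c y) > 0 then inverse (sqrt (det (g c y))) / 2 else - inverse (sqrt (det (g c y))) / 2))
        (at (det (g c y)))"
      using det_metric_nonzero[OF c] by (intro DERIV_real_sqrt_generic) auto
    then show ?thesis
      unfolding r_def by (rule differentiable_compose_real[OF differentiable_det[OF dg]])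
  qed
  then have da: "a i j differentiable (at y)" for i j
    unfolding a_def by (intro differentiable_mult differentiable_matrix_inv dg ev_det)
  have d\<phi>: "partial j \<phi> differentiable (at y)" for j
    using f by (simp add: twice_differentiable_at_def twice_differentiable_def \<phi>_def c_def y_def)
  have "(\<lambda>z. sqrt (det (g c z)) * local_grad g c f z $ i) =
      (\<lambda>z. \<Sum>j\<in>UNIV. a i j z * partial j \<phi> z)" for i
    by (simp add: local_grad_def matrix_vector_mult_def sum_distrib_left a_def r_def \<phi>_def mult.assoc)
  then have "laplacian A g f x =
      (\<Sum>i\<in>UNIV. partial i (\<lambda>z. \<Sum>j\<in>UNIV. a i j z * partial j \<phi> z) y) / r y"
    by (simp add: laplacian_def Let_def local_div_def r_def flip: c_def y_def)
  also have "(\<lambda>i. partial i (\<lambda>z. \<Sum>j\<in>UNIV. a i j z * partial j \<phi> z) y) =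
      (\<lambda>i. \<Sum>j\<in>UNIV. a i j y * partial i (partial j \<phi>) y + partial i (a i j) y * partial j \<phi> y)"
    by (simp add: partial_sum partial_mult differentiable_mult da d\<phi>)
  also have "(\<Sum>i\<in>UNIV. \<Sum>j\<in>UNIV. a i j y * partial i (partial j \<phi>) y + partial i (a i j) y * partial j \<phi> y) / r y =
      (\<Sum>i\<in>UNIV. \<Sum>j\<in>UNIV. (a i j y * partial i (partial j \<phi>) y + partial i (a i j) y * partial j \<phi> y) / r y)"
    by (simp only: sum_divide_distrib)
  also have "\<dots> = (\<Sum>i\<in>UNIV. \<Sum>j\<in>UNIV. inv_metric x i j * partial i (partial j \<phi>) y +
      partial i (a i j) y / r y * partial j \<phi> y)"
    using r by (intro sum.cong refl)
      (simp add: a_def inv_metric_def add_divide_distrib flip: c_def y_def)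
  also have "\<dots> = (\<Sum>i\<in>UNIV. \<Sum>j\<in>UNIV. inv_metric x i j * partial i (partial j \<phi>) y) +
      (\<Sum>i\<in>UNIV. \<Sum>j\<in>UNIV. partial i (a i j) y / r y * partial j \<phi> y)"
    by (simp only: sum.distrib)
  also have "(\<Sum>i\<in>UNIV. \<Sum>j\<in>UNIV. partial i (a i j) y / r y * partial j \<phi> y) =
      (\<Sum>j\<in>UNIV. \<Sum>i\<in>UNIV. partial i (a i j) y / r y * partial j \<phi> y)"
    by (rule sum.swap)
  also have "\<dots> = (\<Sum>j\<in>UNIV. lap_drift x j * partial j \<phi> y)"
    unfolding lap_drift_def Let_def
    by (simp only: sum_distrib_right a_def[abs_def] r_def flip: c_def y_def)
  finally show ?thesis by (simp only: \<phi>_def flip: c_def y_def)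
qed

text \<open>At a maximum the first order part vanishes, and the positive semidefinite inverse metric
  is contracted with a Hessian that is negative semidefinite.\<close>

lemma laplacian_nonpos_at_local_max:
  assumes x: "x \<in> carrier_of A" and f: "twice_differentiable_at A f x"
    and max: "\<forall>\<^sub>F x' in nhds x. f x' \<le> f x"
  shows "laplacian A g f x \<le> 0"
proof -
  let ?c = "chart_at A x" and ?\<phi> = "f \<circ> param (chart_at A x)"
  have c: "?c \<in> A" "x \<in> chart_dom ?c"
    using chart_at_in_atlas[OF x] in_chart_at_dom[OF x] by auto
  have "\<forall>\<^sub>F z in nhds (coord ?c x). ?\<phi> z \<le> ?\<phi> (coord ?c x)"
    using eventually_nhds_coord[OF c max] param_coord[OF c] by simp
  note m = partials_at_local_max[OF f[unfolded twice_differentiable_at_def] this]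
  have "(\<Sum>i\<in>UNIV. \<Sum>j\<in>UNIV. inv_metric x i j * partial i (partial j ?\<phi>) (coord ?c x)) \<le> 0"
    by (rule psd_contraction_nonpos[of UNIV, OF finite inv_metric_sym[OF x] _ inv_metric_psd[OF x] m(2)])
      simp
  then show ?thesis by (simp add: laplacian_eq[OF x f] m(1))
qed

lemma
  assumes x: "x \<in> carrier_of A"
    and f: "twice_differentiable_at A f x" and h: "twice_differentiable_at A h x"
  shows twice_differentiable_at_diff_scale: "twice_differentiable_at A (\<lambda>x. f x - m * h x) x"
    and laplacian_diff_scale:
      "laplacian A g (\<lambda>x. f x - m * h x) x = laplacian A g f x - m * laplacian A g h x"
proof -
  let ?c = "chart_at A x"
  have comp: "(\<lambda>x. f x - m * h x) \<circ> param ?c = (\<lambda>z. (f \<circ> param ?c) z - m * (h \<circ> param ?c) z)"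
    by (simp add: comp_def)
  note f' = f[unfolded twice_differentiable_at_def] and h' = h[unfolded twice_differentiable_at_def]
  show fh: "twice_differentiable_at A (\<lambda>x. f x - m * h x) x"
    unfolding twice_differentiable_at_def comp using f' h' by (rule twice_differentiable_diff_scale)
  show "laplacian A g (\<lambda>x. f x - m * h x) x = laplacian A g f x - m * laplacian A g h x"
    unfolding laplacian_eq[OF x fh] laplacian_eq[OF x f] laplacian_eq[OF x h] comp second_partial_diff_scale(2)[OF f' h']
      partial_diff_scale[OF twice_differentiable_imp_differentiable[OF f']
        twice_differentiable_imp_differentiable[OF h']]
    by (simp add: sum_subtractf sum_distrib_left algebra_simps)
qed

text \<open>The chain rule adds to the Hessian the term \<open>F''\<close> times the product of
  first partials, whose contraction with the inverse metric is the squared gradient norm.\<close>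

lemma
  assumes x: "x \<in> carrier_of A" and f: "twice_differentiable_at A f x"
    and F': "\<forall>\<^sub>F x' in nhds x. (F has_real_derivative F' (f x')) (at (f x'))"
  shows norm_grad_compose: "(norm_grad A g (\<lambda>x. F (f x)) x)\<^sup>2 = (F' (f x))\<^sup>2 * (norm_grad A g f x)\<^sup>2"
    and twice_differentiable_at_compose: "(F' has_real_derivative F'') (at (f x)) \<Longrightarrow>
      twice_differentiable_at A (\<lambda>x. F (f x)) x"
    and laplacian_compose: "(F' has_real_derivative F'') (at (f x)) \<Longrightarrow>
      laplacian A g (\<lambda>x. F (f x)) x =
        F'' * (norm_grad A g f x)\<^sup>2 + F' (f x) * laplacian A g f x"
proof -
  let ?c = "chart_at A x" and ?y = "coord (chart_at A x) x"
  have c: "?c \<in> A" "x \<in> chart_dom ?c"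
    using chart_at_in_atlas[OF x] in_chart_at_dom[OF x] by auto
  have comp: "(\<lambda>x. F (f x)) \<circ> param ?c = (\<lambda>z. F ((f \<circ> param ?c) z))"
    by (simp add: comp_def)
  have fy: "(f \<circ> param ?c) ?y = f x" by (simp add: param_coord[OF c])
  note f' = f[unfolded twice_differentiable_at_def]
  have evF: "\<forall>\<^sub>F z in nhds ?y.
      (F has_real_derivative F' ((f \<circ> param ?c) z)) (at ((f \<circ> param ?c) z))"
    using eventually_nhds_coord[OF c F'] by simp
  have p1: "partial i (\<lambda>z. F ((f \<circ> param ?c) z)) ?y = F' (f x) * partial i (f \<circ> param ?c) ?y" for i
    using partial_compose_real[OF twice_differentiable_imp_differentiable[OF f']
        eventually_nhds_x_imp_x[OF evF]] by (simp only: fy)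
  show "(norm_grad A g (\<lambda>x. F (f x)) x)\<^sup>2 = (F' (f x))\<^sup>2 * (norm_grad A g f x)\<^sup>2"
    unfolding norm_grad_square_eq[OF x] comp p1
    by (simp add: sum_distrib_left power2_eq_square mult_ac)
  assume "(F' has_real_derivative F'') (at (f x))"
  then have F'': "(F' has_real_derivative F'') (at ((f \<circ> param ?c) ?y))" by (simp only: fy)
  show Ff: "twice_differentiable_at A (\<lambda>x. F (f x)) x"
    unfolding twice_differentiable_at_def comp
    using f' evF F'' by (rule twice_differentiable_compose_real)
  show "laplacian A g (\<lambda>x. F (f x)) x =
      F'' * (norm_grad A g f x)\<^sup>2 + F' (f x) * laplacian A g f x"
    unfolding laplacian_eq[OF x Ff] laplacian_eq[OF x f] norm_grad_square_eq[OF x] comp second_partial_compose_real(2)[OF f' evF F''] p1 fy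
    by (simp add: sum.distrib sum_distrib_left algebra_simps)
qed

section \<open>Comparison principle\<close>

text \<open>If the maximum \<open>m\<close> of \<open>u / w\<close> exceeded 1, it would be attained
  at some \<open>q\<close> in \<open>W\<close>, and \<open>u - m * w\<close> would have a local
  maximum there with value 0. Then the Laplacian of \<open>u\<close> at \<open>q\<close> is at most
  \<open>m\<close> times that of \<open>w\<close>, hence strictly below \<open>- V q * u q\<close>.
  The quotient is used because for positive \<open>V\<close> the operator \<Delta> + V has no
  maximum principle of its own; the positive strict supersolution provides one.\<close>

lemma subsolution_le_supersolution:
  assumes Z: "compact Z" "Z \<subseteq> carrier_of A" and W: "open W" "W \<subseteq> Z"
    and u: "\<And>x. x \<in> Z \<Longrightarrow> twice_differentiable_at A u x"
    and w: "\<And>x. x \<in> Z \<Longrightarrow> twice_differentiable_at A w x"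
    and pos: "\<And>x. x \<in> Z \<Longrightarrow> w x > 0"
    and bdry: "\<And>x. x \<in> Z - W \<Longrightarrow> u x \<le> w x"
    and sub: "\<And>x. x \<in> W \<Longrightarrow> laplacian A g u x \<ge> - V x * u x"
    and super: "\<And>x. x \<in> W \<Longrightarrow> laplacian A g w x < - V x * w x"
    and x: "x \<in> Z"
  shows "u x \<le> w x"
proof (rule ccontr)
  assume not: "\<not> u x \<le> w x"
  have "isCont u z" "isCont w z" if "z \<in> Z" for z
    using that u w Z(2) twice_differentiable_at_imp_isCont by blast+
  then have "continuous_on Z u" "continuous_on Z w"
    by (auto intro: continuous_at_imp_continuous_on)
  then have "continuous_on Z (\<lambda>z. u z / w z)"
    using pos by (intro continuous_on_divide) force+
  then obtain q where q: "q \<in> Z" "\<And>z. z \<in> Z \<Longrightarrow> u z / w z \<le> u q / w q"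
    using continuous_attains_sup[OF Z(1)] x by blast
  define m where "m = u q / w q"
  have "u x / w x > 1" using not pos[OF x] by simp
  then have m: "m > 1" using q(2)[OF x] by (simp add: m_def)
  then have "u q > w q" using pos[OF q(1)] by (simp add: m_def)
  then have qW: "q \<in> W" using bdry q(1) by force
  have qM: "q \<in> carrier_of A" using q(1) Z(2) by blast
  have uq: "u q = m * w q" using pos[OF q(1)] by (simp add: m_def)
  have "u z \<le> m * w z" if "z \<in> Z" for z
    using q(2)[OF that, folded m_def] pos[OF that] by (simp add: pos_divide_le_eq)
  then have "u z - m * w z \<le> u q - m * w q" if "z \<in> W" for z
    using that W(2) by (auto simp: uq)
  then have "\<forall>\<^sub>F z in nhds q. u z - m * w z \<le> u q - m * w q"
    using W(1) qW unfolding eventually_nhds by blast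
  then have "laplacian A g (\<lambda>z. u z - m * w z) q \<le> 0"
    using qM q(1) u w by (intro laplacian_nonpos_at_local_max twice_differentiable_at_diff_scale)
  then have "laplacian A g u q \<le> m * laplacian A g w q"
    using laplacian_diff_scale[OF qM u w] q(1) by simp
  also have "\<dots> < m * (- V q * w q)"
    using super[OF qW] m by (intro mult_strict_left_mono) auto
  also have "\<dots> = - V q * u q" by (simp add: uq)
  finally show False using sub[OF qW] by simp
qed

end

section \<open>The end of the manifold\<close>

locale harmonic_end = riemannian_manifold A g
  for A :: "('a::{t2_space, second_countable_topology}, 'n::finite) chart set"
    and g :: "('a, 'n) metric_tensor" +
  fixes K :: "'a set" and h :: "'a \<Rightarrow> real" and \<nu> c :: real
  assumes \<nu>: "\<nu> > 0" and c: "c > 0" and K: "compact K"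
    and h_pos: "x \<in> carrier_of A - K \<Longrightarrow> h x > 0"
    and harmonic: "harmonic_on A g (carrier_of A - K) h"
    and proper: "proper_outside (carrier_of A) K (\<lambda>x. h x powr (- 1 / \<nu>))"
    and norm_grad_ge: "x \<in> carrier_of A - K \<Longrightarrow> norm_grad A g (\<lambda>x. h x powr (- 1 / \<nu>)) x \<ge> c"
begin

abbreviation \<rho> :: "'a \<Rightarrow> real" where
  "\<rho> \<equiv> (\<lambda>x. h x powr (- 1 / \<nu>))"

abbreviation E :: "'a set" where
  "E \<equiv> carrier_of A - K"

text \<open>The constant in the lower bound \<open>norm_grad_h\<close>.\<close>

abbreviation \<kappa> :: real where
  "\<kappa> \<equiv> \<nu>\<^sup>2 * c\<^sup>2"

lemma open_E: "open E"
  using open_carrier compact_imp_closed[OF K] by blast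

lemma h_twice_differentiable: "x \<in> E \<Longrightarrow> twice_differentiable_at A h x"
  using harmonic open_E C2_on_imp_twice_differentiable_at unfolding harmonic_on_def by blast

lemma rho_pos: "x \<in> E \<Longrightarrow> \<rho> x > 0"
  using h_pos[of x] by simp

lemma h_powr: "x \<in> E \<Longrightarrow> h x powr s = \<rho> x powr (- \<nu> * s)"
  using \<nu> by (simp add: powr_powr)

lemma h_rho: "x \<in> E \<Longrightarrow> h x = \<rho> x powr (- \<nu>)"
  using h_powr[of x 1] h_pos[of x] by simp

lemma eventually_h_pos: "x \<in> E \<Longrightarrow> \<forall>\<^sub>F x' in nhds x. h x' > 0"
  using eventually_nhds_in_open[OF open_E] by (rule eventually_mono) (simp_all add: h_pos)

text \<open>Since \<open>\<rho>\<close> is the power \<open>- 1 / \<nu>\<close> of \<open>h\<close>,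
  its gradient norm is \<open>\<rho> x / (\<nu> * h x)\<close> times that of \<open>h\<close>; the
  bound is the hypothesis on \<open>\<rho>\<close> solved for the latter.\<close>

lemma norm_grad_h:
  assumes x: "x \<in> E"
  shows "(norm_grad A g h x)\<^sup>2 \<ge> \<kappa> * \<rho> x powr - 2 * (h x)\<^sup>2"
proof -
  let ?F' = "\<lambda>r. (- 1 / \<nu>) * r powr (- 1 / \<nu> - 1)"
  have hx: "h x > 0" using x by (rule h_pos)
  have "\<forall>\<^sub>F x' in nhds x. ((\<lambda>r. r powr (- 1 / \<nu>)) has_real_derivative ?F' (h x')) (at (h x'))"
    using eventually_h_pos[OF x] by (rule eventually_mono) (rule has_real_derivative_powr)
  then have eq: "(norm_grad A g \<rho> x)\<^sup>2 = (?F' (h x))\<^sup>2 * (norm_grad A g h x)\<^sup>2"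
    using x h_twice_differentiable by (intro norm_grad_compose) auto
  have F': "?F' (h x) = - \<rho> x / (\<nu> * h x)"
    using hx by (simp add: powr_diff)
  have "c\<^sup>2 \<le> (norm_grad A g \<rho> x)\<^sup>2"
    using norm_grad_ge[OF x] c by (intro power_mono) auto
  also have "\<dots> = (\<rho> x)\<^sup>2 / (\<nu>\<^sup>2 * (h x)\<^sup>2) * (norm_grad A g h x)\<^sup>2"
    unfolding eq F' by (simp add: power_divide power_mult_distrib)
  finally have "c\<^sup>2 * (\<nu>\<^sup>2 * (h x)\<^sup>2) \<le> (\<rho> x)\<^sup>2 * (norm_grad A g h x)\<^sup>2"
    using hx \<nu> by (simp add: field_simps)
  moreover have "\<rho> x powr - 2 = 1 / (\<rho> x)\<^sup>2"
    using rho_pos[OF x] by (simp add: powr_minus_divide)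
  ultimately show ?thesis
    using rho_pos[OF x] by (simp add: pos_divide_le_eq mult_ac)
qed

text \<open>Here \<open>w = F \<circ> h\<close> and \<open>Q\<close> is
  \<open>- h\<^sup>2 * F''(h)\<close>. As \<open>h\<close> is harmonic, only \<open>F''(h)\<close>
  times the squared gradient remains, and the lower bound on the gradient gives an upper bound on
  the Laplacian precisely when \<open>F''(h)\<close> is nonpositive, that is, when
  \<open>Q x \<ge> 0\<close>. The three terms are the main one, a correction, and one that dominates
  at infinity.\<close>

lemma
  fixes \<alpha> \<beta> \<eta> s\<^sub>1 s\<^sub>2 b :: real
  defines "w \<equiv> \<lambda>x. \<alpha> * h x powr s\<^sub>1 - \<beta> * h x powr s\<^sub>2 + \<eta> * h x powr b"
    and "Q \<equiv> \<lambda>x. \<alpha> * (s\<^sub>1 * (1 - s\<^sub>1)) * h x powr s\<^sub>1 + \<beta> * (s\<^sub>2 * (s\<^sub>2 - 1)) * h x powr s\<^sub>2 +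
      \<eta> * (b * (1 - b)) * h x powr b"
  assumes x: "x \<in> E"
  shows barrier_twice_differentiable: "twice_differentiable_at A w x"
    and laplacian_barrier: "Q x \<ge> 0 \<Longrightarrow> laplacian A g w x \<le> - (\<kappa> * \<rho> x powr - 2 * Q x)"
proof -
  define F where "F r = \<alpha> * r powr s\<^sub>1 - \<beta> * r powr s\<^sub>2 + \<eta> * r powr b" for r
  define F' where "F' r = \<alpha> * (s\<^sub>1 * r powr (s\<^sub>1 - 1)) - \<beta> * (s\<^sub>2 * r powr (s\<^sub>2 - 1)) +
    \<eta> * (b * r powr (b - 1))" for r
  define F'' where "F'' r = \<alpha> * (s\<^sub>1 * ((s\<^sub>1 - 1) * r powr (s\<^sub>1 - 1 - 1))) -
    \<beta> * (s\<^sub>2 * ((s\<^sub>2 - 1) * r powr (s\<^sub>2 - 1 - 1))) + \<eta> * (b * ((b - 1) * r powr (b - 1 - 1)))" for r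
  have w: "w = (\<lambda>x. F (h x))" by (simp add: w_def F_def)
  have hx: "h x > 0" using x by (rule h_pos)
  have F: "(F has_real_derivative F' r) (at r)" if "r > 0" for r
    unfolding F_def F'_def
    by (intro DERIV_add DERIV_diff DERIV_cmult has_real_derivative_powr that)
  have F': "(F' has_real_derivative F'' r) (at r)" if "r > 0" for r
    unfolding F'_def F''_def
    by (intro DERIV_add DERIV_diff DERIV_cmult has_real_derivative_powr that)
  have evF: "\<forall>\<^sub>F x' in nhds x. (F has_real_derivative F' (h x')) (at (h x'))"
    using eventually_h_pos[OF x] by (rule eventually_mono) (rule F)
  have xM: "x \<in> carrier_of A" using x by blast
  note comp = xM h_twice_differentiable[OF x] evF F'[OF hx]
  show "twice_differentiable_at A w x"
    unfolding w using comp by (rule twice_differentiable_at_compose)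
  assume Q: "Q x \<ge> 0"
  have "laplacian A g h x = 0" using harmonic x by (simp add: harmonic_on_def)
  then have lap: "laplacian A g w x = F'' (h x) * (norm_grad A g h x)\<^sup>2"
    unfolding w by (subst laplacian_compose[OF comp]) simp
  have "h x powr (s - 1 - 1) = h x powr s / (h x)\<^sup>2" for s
    using hx by (simp add: powr_diff power2_eq_square)
  then have F'': "F'' (h x) = - Q x / (h x)\<^sup>2"
    using hx by (simp add: F''_def Q_def field_simps)
  have "Q x / (h x)\<^sup>2 * (\<kappa> * \<rho> x powr - 2 * (h x)\<^sup>2) \<le> Q x / (h x)\<^sup>2 * (norm_grad A g h x)\<^sup>2"
    using Q by (intro mult_left_mono norm_grad_h x) simp
  moreover have "Q x / (h x)\<^sup>2 * (\<kappa> * \<rho> x powr - 2 * (h x)\<^sup>2) = \<kappa> * \<rho> x powr - 2 * Q x"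
    using hx by (simp add: mult_ac)
  ultimately show "laplacian A g w x \<le> - (\<kappa> * \<rho> x powr - 2 * Q x)"
    unfolding lap F'' by simp
qed

section \<open>Shells between level sets of \<open>\<rho>\<close>\<close>

lemma continuous_on_rho: "continuous_on E \<rho>"
proof -
  have "continuous_on E h"
    using h_twice_differentiable twice_differentiable_at_imp_isCont
    by (auto intro!: continuous_at_imp_continuous_on)
  then show ?thesis
    using h_pos by (intro continuous_on_powr continuous_on_const) force+
qed

lemma open_shell: "open {x \<in> E. R < \<rho> x \<and> \<rho> x < S}"
proof -
  have "{x \<in> E. R < \<rho> x \<and> \<rho> x < S} = E \<inter> \<rho> -` {R<..<S}" by auto
  then show ?thesis
    using continuous_open_preimage[OF continuous_on_rho open_E open_greaterThanLessThan] by metis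
qed

text \<open>Let \<open>B\<close> bound \<open>\<rho>\<close> on a neighbourhood \<open>V\<close> of
  \<open>K\<close>. For \<open>R > B\<close> the shell avoids \<open>V\<close>, and by properness it
  lies in a compact set \<open>L\<close>; so it is a closed subset of the compact set
  \<open>L - V\<close>, on which \<open>\<rho>\<close> is continuous.\<close>

lemma compact_shells:
  obtains B where "\<And>R S. R > B \<Longrightarrow> compact {x \<in> E. R \<le> \<rho> x \<and> \<rho> x \<le> S}"
proof -
  obtain V where V: "open V" "K \<subseteq> V" "bdd_above (\<rho> ` ((carrier_of A \<inter> V) - K))"
    using proper unfolding proper_outside_def by blast
  then obtain B where B: "\<And>x. x \<in> E \<inter> V \<Longrightarrow> \<rho> x \<le> B"
    unfolding bdd_above_def by blast
  show ?thesis
  proof (rule that)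
    fix R S assume "R > B"
    obtain L where L: "compact L" "L \<subseteq> carrier_of A" "\<And>x. x \<in> carrier_of A - (K \<union> L) \<Longrightarrow> \<rho> x > S"
      using proper unfolding proper_outside_def by meson
    have D: "compact (L - V)" "L - V \<subseteq> E" using L V by (auto intro: compact_diff)
    have "{x \<in> E. R \<le> \<rho> x \<and> \<rho> x \<le> S} = (L - V) \<inter> ((L - V) \<inter> \<rho> -` {R..S})"
      using B L(3) \<open>R > B\<close> D(2) by force
    moreover have "closed ((L - V) \<inter> \<rho> -` {R..S})"
      using D continuous_on_subset[OF continuous_on_rho] compact_imp_closed
      by (intro continuous_closed_preimage) auto
    ultimately show "compact {x \<in> E. R \<le> \<rho> x \<and> \<rho> x \<le> S}"
      using compact_Int_closed[OF D(1)] by metis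
  qed
qed

text \<open>The term \<open>\<eta> h\<^sup>b\<close> decays slower than the a priori bound on \<open>u\<close>, so it dominates \<open>u\<close> at
  infinity; afterwards \<open>\<eta>\<close> tends to \<open>0\<close>.\<close>

lemma exterior_comparison:
  fixes \<alpha> \<beta> s\<^sub>1 s\<^sub>2 b q \<epsilon> R :: real
  defines "w \<equiv> \<lambda>x. \<alpha> * h x powr s\<^sub>1 - \<beta> * h x powr s\<^sub>2"
    and "Q \<equiv> \<lambda>x. \<alpha> * (s\<^sub>1 * (1 - s\<^sub>1)) * h x powr s\<^sub>1 + \<beta> * (s\<^sub>2 * (s\<^sub>2 - 1)) * h x powr s\<^sub>2"
  assumes shells: "\<And>S. compact {x \<in> E. R \<le> \<rho> x \<and> \<rho> x \<le> S}"
    and "R > 0" "\<epsilon> > 0" and b: "0 < b" "b < 1" "\<nu> * b < q"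
    and u: "\<And>x. x \<in> E \<Longrightarrow> R \<le> \<rho> x \<Longrightarrow> twice_differentiable_at A u x"
    and u_le: "\<And>x. x \<in> E \<Longrightarrow> R \<le> \<rho> x \<Longrightarrow> u x \<le> \<epsilon> * \<rho> x powr - q"
    and sub: "\<And>x. x \<in> E \<Longrightarrow> R \<le> \<rho> x \<Longrightarrow> laplacian A g u x \<ge> - V x * u x"
    and V: "\<And>x. x \<in> E \<Longrightarrow> R \<le> \<rho> x \<Longrightarrow> 0 \<le> V x"
      "\<And>x. x \<in> E \<Longrightarrow> R \<le> \<rho> x \<Longrightarrow> V x < \<kappa> * \<rho> x powr - 2 * (b * (1 - b))"
    and w_nonneg: "\<And>x. x \<in> E \<Longrightarrow> R \<le> \<rho> x \<Longrightarrow> w x \<ge> 0"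
    and super: "\<And>x. x \<in> E \<Longrightarrow> R \<le> \<rho> x \<Longrightarrow> V x * w x \<le> \<kappa> * \<rho> x powr - 2 * Q x"
    and bdry: "\<And>x. x \<in> E \<Longrightarrow> \<rho> x = R \<Longrightarrow> u x \<le> w x"
    and x: "x \<in> E" "R \<le> \<rho> x"
  shows "u x \<le> w x"
proof -
  have *: "u x \<le> w x + \<eta> * h x powr b" if \<eta>: "\<eta> > 0" for \<eta>
  proof -
    let ?w = "\<lambda>x. w x + \<eta> * h x powr b"
    \<comment> \<open>The value of \<open>\<rho>\<close> at which
      \<open>\<epsilon> * \<rho> powr - q\<close> and
      \<open>\<eta> * \<rho> powr (- \<nu> * b)\<close> agree; beyond it the second is larger
      because \<open>\<nu> * b < q\<close>.\<close>
    define T where "T = (\<eta> / \<epsilon>) powr (- 1 / (q - \<nu> * b))"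
    \<comment> \<open>Large enough to place \<open>x\<close> inside the shell as well.\<close>
    define S where "S = max T (\<rho> x + R + 1)"
    let ?Z = "{x \<in> E. R \<le> \<rho> x \<and> \<rho> x \<le> S}" and ?W = "{x \<in> E. R < \<rho> x \<and> \<rho> x < S}"
    have outer: "u z \<le> ?w z" if z: "z \<in> E" "\<rho> z = S" for z
    proof -
      have S: "R \<le> S" "T \<le> S" using \<open>R > 0\<close> x by (auto simp: S_def)
      have T: "T > 0" using \<eta> \<open>\<epsilon> > 0\<close> by (simp add: T_def)
      have "S powr (\<nu> * b - q) \<le> T powr (\<nu> * b - q)"
        using S T b by (intro powr_mono2') auto
      also have "\<dots> = \<eta> / \<epsilon>"
      proof -
        have "- 1 / (q - \<nu> * b) * (\<nu> * b - q) = 1" using b by (simp add: field_simps)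
        then show ?thesis using \<eta> \<open>\<epsilon> > 0\<close> by (simp only: T_def powr_powr) simp
      qed
      finally have "\<epsilon> * S powr (\<nu> * b - q) \<le> \<eta>"
        using \<open>\<epsilon> > 0\<close> by (simp add: field_simps)
      then have "\<epsilon> * (S powr (\<nu> * b - q) * S powr (- \<nu> * b)) \<le> \<eta> * S powr (- \<nu> * b)"
        unfolding mult.assoc[symmetric] by (rule mult_right_mono) simp
      moreover have "S powr (\<nu> * b - q) * S powr (- \<nu> * b) = S powr - q"
        by (simp flip: powr_add)
      ultimately have "\<epsilon> * S powr - q \<le> \<eta> * h z powr b"
        using h_powr[OF z(1), of b] z(2) by simp
      then show ?thesis using u_le[OF z(1)] w_nonneg[OF z(1)] z(2) S(1) by force
    qed
    show ?thesis
    proof (rule subsolution_le_supersolution[where Z = ?Z and W = ?W and V = V])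
      show "compact ?Z" by (rule shells)
      show "open ?W" by (rule open_shell)
      show "?Z \<subseteq> carrier_of A" "?W \<subseteq> ?Z" by auto
      show "twice_differentiable_at A u z" if "z \<in> ?Z" for z using u that by blast
      show "twice_differentiable_at A ?w z" if "z \<in> ?Z" for z
        unfolding w_def using barrier_twice_differentiable that by blast
      show "?w z > 0" if "z \<in> ?Z" for z
        using that w_nonneg[of z] \<eta> h_pos[of z] by (simp add: add_nonneg_pos)
      show "u z \<le> ?w z" if z: "z \<in> ?Z - ?W" for z
      proof -
        consider "z \<in> E" "\<rho> z = R" | "z \<in> E" "\<rho> z = S" using z by force
        then show ?thesis
        proof cases
          case 1
          then show ?thesis using bdry[OF 1] \<eta> by (simp add: add_increasing2)
        qed (rule outer)
      qed
      show "laplacian A g u z \<ge> - V z * u z" if "z \<in> ?W" for z using sub that by force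
      show "laplacian A g ?w z < - V z * ?w z" if "z \<in> ?W" for z
      proof -
        have z: "z \<in> E" "R \<le> \<rho> z" using that by auto
        define k where "k = \<kappa> * \<rho> z powr - 2"
        have k: "k > 0" using \<nu> c rho_pos[OF z(1)] by (simp add: k_def)
        \<comment> \<open>The sign of \<open>Q\<close> follows from \<open>super\<close>, whose left
          side is nonnegative; \<open>laplacian_barrier\<close> requires it.\<close>
        have "0 \<le> k * Q z"
          using super[OF z] V(1)[OF z] w_nonneg[OF z] by (simp add: k_def order_trans[rotated])
        then have "Q z \<ge> 0" using k by (simp add: zero_le_mult_iff)
        moreover have hb: "\<eta> * h z powr b > 0" using h_pos[OF z(1)] \<eta> by simp
        ultimately have "Q z + \<eta> * (b * (1 - b)) * h z powr b \<ge> 0"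
          using b \<eta> by (intro add_nonneg_nonneg mult_nonneg_nonneg) auto
        then have "laplacian A g ?w z \<le> - (k * (Q z + \<eta> * (b * (1 - b)) * h z powr b))"
          unfolding w_def k_def Q_def by (intro laplacian_barrier[OF z(1)]) simp
        \<comment> \<open>The strictness demanded by the comparison principle comes from the
          \<open>\<eta>\<close> term; \<open>super\<close> for \<open>w\<close> itself is not
          strict.\<close>
        also have "V z * (\<eta> * h z powr b) < k * (b * (1 - b)) * (\<eta> * h z powr b)"
          unfolding k_def by (intro mult_strict_right_mono V(2) z hb)
        then have "- (k * (Q z + \<eta> * (b * (1 - b)) * h z powr b)) < - V z * ?w z"
          using super[OF z] by (simp add: k_def algebra_simps)
        finally show ?thesis .
      qed
      show "x \<in> ?Z" using x \<open>R > 0\<close> by (simp add: S_def)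
    qed
  qed
  show ?thesis
  proof (rule field_le_epsilon)
    fix e :: real assume "e > 0"
    then show "u x \<le> w x + e"
      using *[of "e / h x powr b"] h_pos[OF x(1)] by simp
  qed
qed

text \<open>The three bounds on \<open>\<theta>\<close> serve, in order, the barrier
  \<open>h powr s\<close>, the auxiliary term \<open>h powr b\<close>, and the final barrier with
  exponent \<open>1 + t\<close>, whose correction has coefficient 1/2. The number
  \<open>\<nu> * t\<close> is the guaranteed gain of \<open>V\<close> over the power -2 of
  \<open>\<rho>\<close>: the term with \<open>C\<^sub>2\<close> gains \<open>\<tau>\<close>, and the
  term with \<open>C\<^sub>1\<close> gains \<open>\<nu> * s * p - 2\<close> once \<open>u\<close>
  decays with exponent \<open>\<nu> * s\<close>.\<close>

lemma decay_estimate: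
  fixes p \<tau> C\<^sub>1 C\<^sub>2 s b \<theta> \<epsilon> R :: real
  defines "q \<equiv> 2 / p" and "t \<equiv> min \<tau> (\<nu> * s * p - 2) / \<nu>"
  assumes p: "p > 0" and \<tau>: "\<tau> > 0" and C: "C\<^sub>1 > 0" "C\<^sub>2 \<ge> 0"
    and s: "s < 1" "q < \<nu> * s" and b: "0 < b" "b < 1" "\<nu> * b < q"
    and \<theta>: "\<theta> \<le> \<kappa> * (s * (1 - s))" "\<theta> \<le> \<kappa> * (b * (1 - b))" "\<theta> \<le> \<kappa> * (t * (1 + t)) / 2"
    and shells: "\<And>S. compact {x \<in> E. R \<le> \<rho> x \<and> \<rho> x \<le> S}"
    and R: "R > 0" and \<epsilon>: "\<epsilon> > 0" and small: "C\<^sub>1 * \<epsilon> powr p + C\<^sub>2 * R powr - \<tau> < \<theta>"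
    and u: "\<And>x. x \<in> E \<Longrightarrow> R \<le> \<rho> x \<Longrightarrow> twice_differentiable_at A u x"
    and u_nonneg: "\<And>x. x \<in> E \<Longrightarrow> R \<le> \<rho> x \<Longrightarrow> u x \<ge> 0"
    and u_le: "\<And>x. x \<in> E \<Longrightarrow> R \<le> \<rho> x \<Longrightarrow> u x \<le> \<epsilon> * \<rho> x powr - q"
    and sub: "\<And>x. x \<in> E \<Longrightarrow> R \<le> \<rho> x \<Longrightarrow>
      laplacian A g u x \<ge> - C\<^sub>1 * u x powr (p + 1) - C\<^sub>2 * \<rho> x powr (- 2 - \<tau>) * u x"
    and x: "x \<in> E" "R \<le> \<rho> x"
  shows "u x \<le> 2 * \<epsilon> * R powr (\<nu> - q) * \<rho> x powr - \<nu>"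
proof -
  have q: "q > 0" "q * p = 2" using p by (auto simp: q_def)
  have s0: "s > 0" using q(1) s(2) \<nu> by (meson less_trans zero_less_mult_pos)
  have "\<nu> * s * p > 2" using s(2) p q(2) by (metis mult_strict_right_mono)
  then have t: "t > 0" "\<nu> * t \<le> \<tau>" "\<nu> * t \<le> \<nu> * s * p - 2"
    using \<tau> \<nu> by (auto simp: t_def)
  define V where "V x = C\<^sub>1 * u x powr p + C\<^sub>2 * \<rho> x powr (- 2 - \<tau>)" for x
  have V0: "V x \<ge> 0" for x using C by (simp add: V_def)
  have sub_V: "laplacian A g u x \<ge> - V x * u x" if "x \<in> E" "R \<le> \<rho> x" for x
    using sub[OF that] u_nonneg[OF that] by (simp add: V_def powr_add algebra_simps)
  have u_powr_le: "u z powr p \<le> a powr p * \<rho> z powr (- e * p)"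
    if "z \<in> E" "R \<le> \<rho> z" "u z \<le> a * \<rho> z powr - e" "a \<ge> 0" for z a e
  proof -
    have "u z powr p \<le> (a * \<rho> z powr - e) powr p"
      using that p u_nonneg by (intro powr_mono2) auto
    also have "\<dots> = a powr p * (\<rho> z powr - e) powr p" by (rule powr_mult)
    also have "(\<rho> z powr - e) powr p = \<rho> z powr (- e * p)" by (rule powr_powr)
    finally show ?thesis .
  qed
  have split: "r powr (- 2 - e) = R powr - e * (R / r) powr e * r powr - 2"
    "R powr e * r powr - e = (R / r) powr e" if "r > 0" for r e :: real
    using R that by (simp_all add: powr_divide powr_minus_divide powr_diff)
  note \<rho>_split = split[OF rho_pos]
  have ratio: "0 < R / \<rho> z" "R / \<rho> z \<le> 1" if "z \<in> E" "R \<le> \<rho> z" for z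
    using that R rho_pos[OF that(1)] by auto
  \<comment> \<open>The exponent \<open>d\<close> records the gain in decay: 0 in the first
    comparison, \<open>\<nu> * t\<close> in the second.\<close>
  have V_le: "V z \<le> \<theta> * (R / \<rho> z) powr d * \<rho> z powr - 2"
    if z: "z \<in> E" "R \<le> \<rho> z" and d: "d \<le> \<tau>"
      and uz: "u z powr p \<le> \<epsilon> powr p * (R / \<rho> z) powr d * \<rho> z powr - 2" for z d
  proof -
    have "(R / \<rho> z) powr \<tau> \<le> (R / \<rho> z) powr d"
      using ratio[OF z] d by (intro powr_mono') auto
    then have "C\<^sub>2 * \<rho> z powr (- 2 - \<tau>) \<le> C\<^sub>2 * (R powr - \<tau> * (R / \<rho> z) powr d * \<rho> z powr - 2)"
      unfolding \<rho>_split(1)[OF z(1)] using C by (intro mult_left_mono mult_right_mono) auto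
    moreover have "C\<^sub>1 * u z powr p \<le> C\<^sub>1 * (\<epsilon> powr p * (R / \<rho> z) powr d * \<rho> z powr - 2)"
      using uz C by simp
    ultimately have "V z \<le> (C\<^sub>1 * \<epsilon> powr p + C\<^sub>2 * R powr - \<tau>) * ((R / \<rho> z) powr d * \<rho> z powr - 2)"
      by (simp add: V_def algebra_simps)
    also have "\<dots> \<le> \<theta> * ((R / \<rho> z) powr d * \<rho> z powr - 2)"
      using small by (intro mult_right_mono) auto
    finally show ?thesis by (simp add: mult.assoc)
  qed
  have \<theta>_pos: "\<theta> > 0"
    using small C by (smt (verit) mult_nonneg_nonneg powr_ge_zero)
  \<comment> \<open>A strict form of \<open>V_le\<close> for \<open>d = 0\<close>, as the
    \<open>\<eta>\<close> term of \<open>exterior_comparison\<close> demands; the strictness comes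
    from \<open>small\<close>.\<close>
  have V_small: "V z < \<kappa> * \<rho> z powr - 2 * (b * (1 - b))" if z: "z \<in> E" "R \<le> \<rho> z" for z
  proof -
    have "u z powr p \<le> \<epsilon> powr p * \<rho> z powr - 2"
      using u_powr_le[OF z u_le[OF z]] \<epsilon> q(2) by simp
    then have "C\<^sub>1 * u z powr p \<le> C\<^sub>1 * (\<epsilon> powr p * \<rho> z powr - 2)" using C by simp
    moreover have "(R / \<rho> z) powr \<tau> \<le> 1"
      using ratio[OF z] \<tau> by (intro powr_le1) auto
    then have "C\<^sub>2 * \<rho> z powr (- 2 - \<tau>) \<le> C\<^sub>2 * (R powr - \<tau> * 1 * \<rho> z powr - 2)"
      unfolding \<rho>_split(1)[OF z(1)] using C by (intro mult_left_mono mult_right_mono) auto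
    ultimately have "V z \<le> (C\<^sub>1 * \<epsilon> powr p + C\<^sub>2 * R powr - \<tau>) * \<rho> z powr - 2"
      by (simp add: V_def algebra_simps)
    also have "\<dots> < \<theta> * \<rho> z powr - 2"
      using small rho_pos[OF z(1)] by (intro mult_strict_right_mono) auto
    also have "\<dots> \<le> \<kappa> * (b * (1 - b)) * \<rho> z powr - 2"
      using \<theta>(2) by (intro mult_right_mono) auto
    finally show ?thesis by (simp add: mult_ac)
  qed
  note compare = exterior_comparison[OF shells R \<epsilon> b u u_le sub_V V0 V_small]

  have first: "u z \<le> \<epsilon> * R powr (\<nu> * s - q) * \<rho> z powr - (\<nu> * s)"
    if z: "z \<in> E" "R \<le> \<rho> z" for z
  proof -
    \<comment> \<open>Chosen so that \<open>?a * h powr s\<close> equals the a priori bound on the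
      level set \<open>\<rho> = R\<close>. The zero term below brings this single power into the
      two-term form of \<open>exterior_comparison\<close>.\<close>
    let ?a = "\<epsilon> * R powr (\<nu> * s - q)"
    have "u z \<le> ?a * h z powr s - 0 * h z powr 1"
    proof (rule compare)
      fix y assume y: "y \<in> E" "R \<le> \<rho> y"
      show "0 \<le> ?a * h y powr s - 0 * h y powr 1" using \<epsilon> by simp
      have "V y \<le> \<theta> * \<rho> y powr - 2"
        using V_le[OF y, of 0] \<tau> u_powr_le[OF y u_le[OF y]] \<epsilon> q(2) R rho_pos[OF y(1)] by simp
      also have "\<dots> \<le> \<kappa> * (s * (1 - s)) * \<rho> y powr - 2"
        using \<theta>(1) by (intro mult_right_mono) auto
      finally have "V y * (?a * h y powr s) \<le> \<kappa> * (s * (1 - s)) * \<rho> y powr - 2 * (?a * h y powr s)"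
        using \<epsilon> by (intro mult_right_mono) auto
      then show "V y * (?a * h y powr s - 0 * h y powr 1) \<le>
          \<kappa> * \<rho> y powr - 2 * (?a * (s * (1 - s)) * h y powr s + 0 * (1 * (1 - 1)) * h y powr 1)"
        by (simp add: mult_ac)
    next
      fix y assume y: "y \<in> E" "\<rho> y = R"
      have "R powr (\<nu> * s - q) * h y powr s = R powr - q"
        unfolding h_powr[OF y(1), of s, unfolded y(2)] by (simp flip: powr_add)
      then show "u y \<le> ?a * h y powr s - 0 * h y powr 1"
        using u_le[OF y(1)] y(2) by (simp add: mult.assoc)
    qed (use z in auto)
    also have "\<dots> = ?a * \<rho> z powr (- \<nu> * s)"
      using h_powr[OF z(1), of s] by (simp only: mult_zero_left diff_zero)
    finally show ?thesis by simp
  qed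

  \<comment> \<open>The factor 2 compensates for the correction, which halves the barrier at
    \<open>\<rho> = R\<close>.\<close>
  define a where "a = 2 * \<epsilon> * R powr (\<nu> - q)"
  have a: "a > 0" using \<epsilon> R by (simp add: a_def)
  \<comment> \<open>The correction relative to \<open>h\<close>: the barrier becomes
    \<open>a * h * (1 - X / 2)\<close> with \<open>X\<close> between 0 and 1.\<close>
  define X where "X z = (R / \<rho> z) powr (\<nu> * t)" for z
  have hX: "R powr (\<nu> * t) * h z powr (1 + t) = h z * X z" if "z \<in> E" for z
  proof -
    have "h z powr (1 + t) = h z * h z powr t"
      using h_pos[OF that] by (simp add: powr_add)
    also have "h z powr t = \<rho> z powr - (\<nu> * t)"
      unfolding mult_minus_left[symmetric] by (rule h_powr[OF that])
    finally have "h z powr (1 + t) = h z * \<rho> z powr - (\<nu> * t)" .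
    then have "R powr (\<nu> * t) * h z powr (1 + t) =
        h z * (R powr (\<nu> * t) * \<rho> z powr - (\<nu> * t))"
      by simp
    then show ?thesis unfolding \<rho>_split(2)[OF that] X_def .
  qed
  have w: "a * h z powr 1 - a * R powr (\<nu> * t) / 2 * h z powr (1 + t) = a * h z * (1 - X z / 2)"
    if "z \<in> E" for z
  proof -
    have "a * R powr (\<nu> * t) / 2 * h z powr (1 + t) = a / 2 * (h z * X z)"
      by (simp flip: hX[OF that])
    moreover have "h z powr 1 = h z" using h_pos[OF that] by simp
    ultimately show ?thesis by (simp only:) (simp add: algebra_simps)
  qed
  have X: "0 \<le> X z" "X z \<le> 1" if "z \<in> E" "R \<le> \<rho> z" for z
    unfolding X_def using ratio[OF that] t \<nu> by (auto intro!: powr_le1)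
  have "u x \<le> a * h x powr 1 - a * R powr (\<nu> * t) / 2 * h x powr (1 + t)"
  proof (rule compare)
    fix y assume y: "y \<in> E" "R \<le> \<rho> y"
    have ah: "a * h y > 0" using a h_pos[OF y(1)] by simp
    show "0 \<le> a * h y powr 1 - a * R powr (\<nu> * t) / 2 * h y powr (1 + t)"
      unfolding w[OF y(1)] using ah X[OF y] by (intro mult_nonneg_nonneg[OF less_imp_le]) auto
    \<comment> \<open>The decay from \<open>first\<close> is fed back into the potential; the powers
      of \<open>R\<close> and \<open>\<rho>\<close> combine to the ratio to the power
      \<open>\<nu> * s * p - 2\<close>.\<close>
    have "u y powr p \<le> (\<epsilon> * R powr (\<nu> * s - q)) powr p * \<rho> y powr (- (\<nu> * s) * p)"
      using u_powr_le[OF y first[OF y]] \<epsilon> by simp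
    also have "(\<epsilon> * R powr (\<nu> * s - q)) powr p = \<epsilon> powr p * R powr (\<nu> * s * p - 2)"
      using \<epsilon> q(2) by (simp add: powr_mult powr_powr algebra_simps)
    also have "\<rho> y powr (- (\<nu> * s) * p) = \<rho> y powr (- 2 - (\<nu> * s * p - 2))"
      by simp
    also have "\<epsilon> powr p * R powr (\<nu> * s * p - 2) * \<dots> =
        \<epsilon> powr p * (R / \<rho> y) powr (\<nu> * s * p - 2) * \<rho> y powr - 2"
      unfolding \<rho>_split(1)[OF y(1)] using R by (simp flip: powr_add)
    \<comment> \<open>The ratio is at most 1, so the exponent may be lowered to
      \<open>\<nu> * t\<close>.\<close>
    also have "\<dots> \<le> \<epsilon> powr p * X y * \<rho> y powr - 2"
      unfolding X_def using ratio[OF y] t(3)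
      by (intro mult_right_mono mult_left_mono powr_mono') auto
    finally have "V y \<le> \<theta> * X y * \<rho> y powr - 2"
      unfolding X_def using t(2) by (intro V_le y)
    also have "\<dots> \<le> \<kappa> * (t * (1 + t)) / 2 * X y * \<rho> y powr - 2"
      using \<theta>(3) X[OF y] by (intro mult_right_mono) auto
    finally have "V y * (a * h y) \<le> \<kappa> * (t * (1 + t)) / 2 * X y * \<rho> y powr - 2 * (a * h y)"
      using ah by (intro mult_right_mono) auto
    \<comment> \<open>This is \<open>Q\<close> for the barrier: the power 1 of \<open>h\<close>
      contributes nothing because \<open>h\<close> is harmonic, so all the room comes from the
      correction.\<close>
    also have "\<dots> = \<kappa> * \<rho> y powr - 2 * (a / 2 * ((1 + t) * t) * (h y * X y))"
      by (simp add: field_simps)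
    also have "\<dots> = \<kappa> * \<rho> y powr - 2 * (a * (1 * (1 - 1)) * h y powr 1 +
        a * R powr (\<nu> * t) / 2 * ((1 + t) * (1 + t - 1)) * h y powr (1 + t))"
      by (simp flip: hX[OF y(1)])
    finally have le: "V y * (a * h y) \<le> \<dots>" .
    \<comment> \<open>The barrier is at most \<open>a * h\<close>, and \<open>V\<close> is
      nonnegative.\<close>
    have "V y * (a * h y * (1 - X y / 2)) \<le> V y * (a * h y * 1)"
      using ah X[OF y] by (intro mult_left_mono V0) (auto intro: less_imp_le)
    then show "V y * (a * h y powr 1 - a * R powr (\<nu> * t) / 2 * h y powr (1 + t)) \<le>
        \<kappa> * \<rho> y powr - 2 * (a * (1 * (1 - 1)) * h y powr 1 +
        a * R powr (\<nu> * t) / 2 * ((1 + t) * (1 + t - 1)) * h y powr (1 + t))"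
      unfolding w[OF y(1)] using le by linarith
  next
    fix y assume y: "y \<in> E" "\<rho> y = R"
    have "X y = 1" using y(2) R by (simp add: X_def)
    moreover have "h y = R powr - \<nu>" by (rule h_rho[OF y(1), unfolded y(2)])
    ultimately have "a * h y * (1 - X y / 2) = \<epsilon> * (R powr (\<nu> - q) * R powr - \<nu>)"
      by (simp add: a_def)
    also have "R powr (\<nu> - q) * R powr - \<nu> = R powr - q" by (simp flip: powr_add)
    finally show "u y \<le> a * h y powr 1 - a * R powr (\<nu> * t) / 2 * h y powr (1 + t)"
      unfolding w[OF y(1)] using u_le[OF y(1)] y(2) by simp
  qed (use x in auto)
  also have "\<dots> \<le> a * h x * 1"
    unfolding w[OF x(1)] using a h_pos[OF x(1)] X[OF x] by (intro mult_left_mono) auto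
  also have "\<dots> = a * \<rho> x powr - \<nu>" using h_rho[OF x(1)] by (simp only: mult_1_right)
  finally show ?thesis unfolding a_def .
qed

end

section \<open>Choice of the constants\<close>

theorem theorem1:
  fixes A :: "('a::{t2_space, second_countable_topology}, 'n::finite) chart set"
    and g :: "('a, 'n) metric_tensor"
    and K :: "'a set"
    and h \<rho> :: "'a \<Rightarrow> real"
    and p \<nu> \<tau> C\<^sub>1 C\<^sub>2 c\<^sub>0 :: real
  defines "M \<equiv> carrier_of A"
    and "\<rho> \<equiv> (\<lambda>x. h x powr (- 1 / \<nu>))"
  assumes "p > 0" and "\<nu> > 0" and "\<tau> > 0" and "C\<^sub>1 > 0" and "C\<^sub>2 \<ge> 0" and "p * \<nu> > 2"
    and "complete_riemannian_manifold A g"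
    and "compact K" and "K \<subseteq> M"
    and "\<And>x. x \<in> M - K \<Longrightarrow> h x > 0"
    and "harmonic_on A g (M - K) h"
    and "proper_outside M K \<rho>"
    and "c\<^sub>0 > 0"
    and "\<And>x. x \<in> M - K \<Longrightarrow> norm_grad A g \<rho> x \<ge> c\<^sub>0"
  shows "\<exists>R\<^sub>0>0. \<exists>\<epsilon>\<^sub>0>0. \<exists>C>0. \<forall>R \<epsilon>. \<forall>u :: 'a \<Rightarrow> real.
    R > R\<^sub>0 \<longrightarrow> 0 < \<epsilon> \<longrightarrow> \<epsilon> < \<epsilon>\<^sub>0 \<longrightarrow>
    (\<forall>x\<in>M. u x \<ge> 0) \<longrightarrow>
    (\<exists>U. open U \<and> {x \<in> M - K. \<rho> x \<ge> R} \<subseteq> U \<and> U \<subseteq> M \<and> C2_on A U u) \<longrightarrow>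
    (\<forall>x \<in> {x \<in> M - K. \<rho> x \<ge> R}.
       laplacian A g u x \<ge> - C\<^sub>1 * u x powr (p + 1) - C\<^sub>2 * \<rho> x powr (- 2 - \<tau>) * u x \<and>
       u x \<le> \<epsilon> * \<rho> x powr (- 2 / p)) \<longrightarrow>
    (\<forall>x \<in> {x \<in> M - K. \<rho> x \<ge> R}.
       u x \<le> C * \<epsilon> * R powr (\<nu> - 2 / p) * \<rho> x powr (- \<nu>))"
proof -
  interpret complete_riemannian_manifold A g by fact
  interpret harmonic_end A g K h \<nu> c\<^sub>0
    using assms(3-) by unfold_locales (simp_all add: M_def \<rho>_def)
  define q where "q = 2 / p"
  \<comment> \<open>Half of \<open>q / \<nu>\<close>, so that \<open>\<nu> * b < q\<close>; next,
    \<open>s\<close> is the midpoint of \<open>q / \<nu>\<close> and 1, so that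
    \<open>q < \<nu> * s < \<nu>\<close>.\<close>
  define b where "b = q / (2 * \<nu>)"
  define s where "s = (1 + q / \<nu>) / 2"
  define t where "t = min \<tau> (\<nu> * s * p - 2) / \<nu>"
  define k where "k = \<nu>\<^sup>2 * c\<^sub>0\<^sup>2"
  define \<theta> where "\<theta> = min (k * (s * (1 - s))) (min (k * (b * (1 - b))) (k * (t * (1 + t)) / 2))"
  \<comment> \<open>The hypothesis \<open>p * \<nu> > 2\<close> says that the a priori decay is
    slower than that of \<open>h\<close>, which leaves room for \<open>s\<close> below 1.\<close>
  have q: "0 < q" "q < \<nu>"
    using \<open>p > 0\<close> \<open>p * \<nu> > 2\<close> by (auto simp: q_def field_simps)
  have b: "0 < b" "b < 1" "\<nu> * b < q" using q \<open>\<nu> > 0\<close> by (auto simp: b_def field_simps)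
  have s: "0 < s" "s < 1" "q < \<nu> * s" using q \<open>\<nu> > 0\<close> by (auto simp: s_def field_simps)
  have "2 < \<nu> * s * p"
    using mult_strict_right_mono[OF s(3) \<open>p > 0\<close>] \<open>p > 0\<close> by (simp add: q_def)
  then have t: "t > 0" using \<open>\<tau> > 0\<close> \<open>\<nu> > 0\<close> by (simp add: t_def)
  have k: "k > 0" using \<open>\<nu> > 0\<close> \<open>c\<^sub>0 > 0\<close> by (simp add: k_def)
  have \<theta>: "\<theta> > 0" using k b s t by (simp add: \<theta>_def)
  obtain B where B: "\<And>R S. R > B \<Longrightarrow> compact {x \<in> M - K. R \<le> \<rho> x \<and> \<rho> x \<le> S}"
    using compact_shells unfolding M_def \<rho>_def by blast
  \<comment> \<open>Beyond \<open>B\<close> the shells are compact. The remaining thresholds give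
    each of the two terms in \<open>small\<close> at most half of \<open>\<theta>\<close>.\<close>
  define R\<^sub>0 where "R\<^sub>0 = max 1 (max B ((2 * C\<^sub>2 / \<theta>) powr (1 / \<tau>)))"
  define \<epsilon>\<^sub>0 where "\<epsilon>\<^sub>0 = (\<theta> / (2 * C\<^sub>1)) powr (1 / p)"
  have "R\<^sub>0 > 0" "\<epsilon>\<^sub>0 > 0" using \<theta> \<open>C\<^sub>1 > 0\<close> by (auto simp: R\<^sub>0_def \<epsilon>\<^sub>0_def)
  have small: "C\<^sub>1 * \<epsilon> powr p + C\<^sub>2 * R powr - \<tau> < \<theta>" if "R > R\<^sub>0" "0 < \<epsilon>" "\<epsilon> < \<epsilon>\<^sub>0" for R \<epsilon>
  proof -
    have "\<epsilon> powr p < \<epsilon>\<^sub>0 powr p" using that \<open>p > 0\<close> by (intro powr_less_mono2) auto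
    also have "\<dots> = \<theta> / (2 * C\<^sub>1)" using \<theta> \<open>C\<^sub>1 > 0\<close> \<open>p > 0\<close> by (simp add: \<epsilon>\<^sub>0_def powr_powr)
    finally have 1: "C\<^sub>1 * \<epsilon> powr p < \<theta> / 2" using \<open>C\<^sub>1 > 0\<close> by (simp add: field_simps)
    have R: "R > 0" "(2 * C\<^sub>2 / \<theta>) powr (1 / \<tau>) \<le> R" using that by (auto simp: R\<^sub>0_def)
    have "2 * C\<^sub>2 / \<theta> = ((2 * C\<^sub>2 / \<theta>) powr (1 / \<tau>)) powr \<tau>"
      using \<theta> \<open>C\<^sub>2 \<ge> 0\<close> \<open>\<tau> > 0\<close> by (simp add: powr_powr)
    also have "\<dots> \<le> R powr \<tau>" using R(2) \<open>\<tau> > 0\<close> by (intro powr_mono2) auto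
    finally have "C\<^sub>2 * R powr - \<tau> \<le> \<theta> / 2"
      using \<theta> R(1) by (simp add: powr_minus_divide field_simps)
    with 1 show ?thesis by simp
  qed
  have "u x \<le> 2 * \<epsilon> * R powr (\<nu> - 2 / p) * \<rho> x powr (- \<nu>)"
    if R: "R > R\<^sub>0" and \<epsilon>: "0 < \<epsilon>" "\<epsilon> < \<epsilon>\<^sub>0" and u_nonneg: "\<forall>x\<in>M. u x \<ge> 0"
      and u_C2: "\<exists>U. open U \<and> {x \<in> M - K. \<rho> x \<ge> R} \<subseteq> U \<and> U \<subseteq> M \<and> C2_on A U u"
      and u: "\<forall>x \<in> {x \<in> M - K. \<rho> x \<ge> R}.
        laplacian A g u x \<ge> - C\<^sub>1 * u x powr (p + 1) - C\<^sub>2 * \<rho> x powr (- 2 - \<tau>) * u x \<and>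
        u x \<le> \<epsilon> * \<rho> x powr (- 2 / p)"
      and x: "x \<in> M - K" "\<rho> x \<ge> R" for R \<epsilon> x and u :: "'a \<Rightarrow> real"
  proof -
    have "R > 0" "R > B" using R \<open>R\<^sub>0 > 0\<close> by (auto simp: R\<^sub>0_def)
    have smooth: "twice_differentiable_at A u y" if "y \<in> carrier_of A - K" "R \<le> h y powr (- 1 / \<nu>)" for y
      using u_C2 that C2_on_imp_twice_differentiable_at unfolding M_def \<rho>_def by blast
    show ?thesis
      unfolding \<rho>_def
    proof (rule decay_estimate[where s = s and b = b and \<theta> = \<theta>, folded q_def])
      show "\<theta> \<le> \<nu>\<^sup>2 * c\<^sub>0\<^sup>2 * (s * (1 - s))" "\<theta> \<le> \<nu>\<^sup>2 * c\<^sub>0\<^sup>2 * (b * (1 - b))"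
        "\<theta> \<le> \<nu>\<^sup>2 * c\<^sub>0\<^sup>2 * (min \<tau> (\<nu> * s * p - 2) / \<nu> * (1 + min \<tau> (\<nu> * s * p - 2) / \<nu>)) / 2"
        by (auto simp: \<theta>_def simp flip: k_def t_def)
    qed (use assms(3-8) b s \<epsilon> small[OF R \<epsilon>] \<open>R > 0\<close> B[OF \<open>R > B\<close>] u u_nonneg x smooth in
        \<open>auto simp: M_def \<rho>_def q_def\<close>)
  qed
  then show ?thesis
    using \<open>R\<^sub>0 > 0\<close> \<open>\<epsilon>\<^sub>0 > 0\<close>
    by (intro exI[of _ R\<^sub>0] exI[of _ \<epsilon>\<^sub>0] exI[of _ 2] conjI allI impI ballI) auto
qed

end
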